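(* Let $(\mathcal P,g)$ be a Riemannian manifold with induced distance $d_g$, let $\nabla$ be an affine connection on $\mathcal P$ with $g$-dual $\nabla^*$, and let $A$, $M$, $M_g$ be the midpoint maps of $\nabla$, $\nabla^*$ and the Levi--Civita connection $\nabla^g$. Fix $o\in\mathcal P$ and let $\mathcal V$ be a strongly convex normal neighborhood of $o$ with respect to $g$. Suppose that the local midpoint maps $A$ and $M$ are uniquely defined and of class $C^2$ on an open neighborhood $\mathcal W\subset\mathcal V\times\mathcal V$ of $(o,o)$, with $A(X,Y),M(X,Y)\in\mathcal V$ for every $(X,Y)\in\mathcal W$, and that $$M_g\bigl(A(X,Y),M(X,Y)\bigr)=M_g(X,Y)\qquad\text{for every }(X,Y)\in\mathcal W.$$ Put $T(X,Y)=(A(X,Y),M(X,Y))$. Fix a coordinate chart around $o$ with coordinate norm $|\cdot|$, and let $\mathcal K\subset\mathcal V$ (a compact subset of the chart domain), $\mathcal U$, $\mathcal D$, $\varepsilon$, $C$ be local convergence data for $(A,M)$ at $o$ in this chart, as defined in the context. Then there exists a constant $C_g>0$ such that for every $(P_0,Q_0)\in\mathcal D$, with $(P_{n+1},Q_{n+1})=T(P_n,Q_n)$ and $\delta_n:=d_g(P_n,Q_n)$: (1) $(A\otimes M)(P_0,Q_0)=M_g(P_0,Q_0)$; (2) for every $n\ge0$, $$\delta_{n+1}\le C_g\,\delta_n^2,\qquad d_g\bigl(P_n,M_g(P_0,Q_0)\bigr)=d_g\bigl(Q_n,M_g(P_0,Q_0)\bigr)=\frac{\delta_n}{2}.$$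
   Context: Dual connection: $\nabla^*$ is determined by $X[g(Y,Z)]=g(\nabla_XY,Z)+g(Y,\nabla^*_XZ)$. Midpoint map of a connection $D$: $M_D(P,Q)=\gamma(1/2)$, where $\gamma:[0,1]\to\mathcal P$ is the unique affinely parametrized $D$-geodesic with $\gamma(0)=P,\gamma(1)=Q$, uniqueness being understood in the ambient manifold or among geodesic segments contained in the specified convex normal neighborhood; for $\nabla^g$ on $\mathcal V$ the unique minimizing segment is used. Midpoint maps are symmetric and idempotent ($M_D(P,Q)=M_D(Q,P)$, $M_D(P,P)=P$). A neighborhood $\mathcal V$ of $o$ is a normal neighborhood if it is the diffeomorphic image under the Riemannian exponential map at $o$ of a star-shaped open neighborhood of the origin of $T_o\mathcal P$. It is strongly convex with respect to $g$ if any two points of $\mathcal V$ are joined by a unique minimizing $g$-geodesic and this geodesic segment is contained in $\mathcal V$. Gauss composition: $(A\otimes M)(P_0,Q_0)$ is the common limit of $(P_n)$ and $(Q_n)$, if it exists. Local convergence data: a compact set $\mathcal K$ with $\mathcal K\times\mathcal K\subset\mathcal W$, an open neighborhood $\mathcal U\subset\mathcal K$ of $o$, an open set $\mathcal D$ invariant under $(X,Y)\mapsto(Y,X)$ with $T(\mathcal D)\subset\mathcal D\subset\mathcal K\times\mathcal K$, and constants $\varepsilon,C>0$ with $\{(X,Y)\in\mathcal U\times\mathcal U:|X-Y|<\varepsilon\}\subset\mathcal D$, such that for every $(P_0,Q_0)\in\mathcal D$ and all $n\ge 0$: $(P_n,Q_n)\in\mathcal D$; $|P_{n+1}-Q_{n+1}|\le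 C|P_n-Q_n|^2\le\frac12|P_n-Q_n|$; and there is $L(P_0,Q_0)\in\mathcal K$ with $|P_n-L(P_0,Q_0)|\le2|P_n-Q_n|$ and $|Q_n-L(P_0,Q_0)|\le3|P_n-Q_n|$; moreover $L=A\otimes M$ is continuous, symmetric and idempotent on $\mathcal D$ and $|L(X,Y)-\frac12(A(X,Y)+M(X,Y))|\le\frac23C^3|X-Y|^4$ on $\mathcal D$. (Such data with $\mathcal K\subset\mathcal V$ exist for any $C^2$ symmetric idempotent maps $A,M$ near $(o,o)$.) *)

theory Defs
  imports "HOL-Analysis.Analysis"
begin

text \<open>All sets \<open>S\<close> to which the next definition is applied are open, so \<open>at x\<close> is the
  right filter; by induction it says that all partial derivatives of order at most \<open>k\<close>
  exist and are continuous.\<close>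

primrec Ck_on :: "nat \<Rightarrow> ('a::euclidean_space \<Rightarrow> 'b::real_normed_vector) \<Rightarrow> 'a set \<Rightarrow> bool" where
  "Ck_on 0 = (\<lambda>f S. continuous_on S f)"
| "Ck_on (Suc k) = (\<lambda>f S. f differentiable_on S \<and>
     (\<forall>v. Ck_on k (\<lambda>x. frechet_derivative f (at x) v) S))"

definition smooth_on :: "'a::euclidean_space set \<Rightarrow> ('a \<Rightarrow> 'b::real_normed_vector) \<Rightarrow> bool" where
  "smooth_on S f \<longleftrightarrow> (\<forall>k. Ck_on k f S)"

text \<open>A chart is a domain together with a coordinate map; the values of the coordinate map off
  the domain are irrelevant.\<close>

type_synonym ('p, 'e) chart = "'p set \<times> ('p \<Rightarrow> 'e)"

definition chart_inv :: "('p, 'e) chart \<Rightarrow> 'e \<Rightarrow> 'p" where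
  "chart_inv c = inv_into (fst c) (snd c)"

definition is_chart :: "('p::topological_space, 'e::euclidean_space) chart \<Rightarrow> bool" where
  "is_chart c \<longleftrightarrow> open (fst c) \<and> open (snd c ` fst c) \<and>
     homeomorphism (fst c) (snd c ` fst c) (snd c) (chart_inv c)"

definition compatible ::
  "('p::topological_space, 'e::euclidean_space) chart \<Rightarrow> ('p, 'e) chart \<Rightarrow> bool" where
  "compatible c d \<longleftrightarrow>
     smooth_on (snd c ` (fst c \<inter> fst d)) (snd d \<circ> chart_inv c) \<and>
     smooth_on (snd d ` (fst c \<inter> fst d)) (snd c \<circ> chart_inv d)"

text \<open>The manifold is the whole type \<open>'p\<close>; being Hausdorff and second countable is imposed
  through type classes in the theorem. Atlases are maximal, so ``a chart'' of the manifold is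
  just an element of the atlas.\<close>

definition smooth_structure :: "('p::topological_space, 'e::euclidean_space) chart set \<Rightarrow> bool" where
  "smooth_structure \<A> \<longleftrightarrow>
     (\<forall>c\<in>\<A>. is_chart c) \<and> (\<Union>c\<in>\<A>. fst c) = UNIV \<and>
     (\<forall>c\<in>\<A>. \<forall>d\<in>\<A>. compatible c d) \<and>
     (\<forall>c. is_chart c \<and> (\<forall>d\<in>\<A>. compatible c d) \<longrightarrow> c \<in> \<A>)"

definition Ck_map ::
  "nat \<Rightarrow> ('p::topological_space, 'e::euclidean_space) chart set \<Rightarrow>
     ('q::topological_space, 'f::euclidean_space) chart set \<Rightarrow> 'p set \<Rightarrow> ('p \<Rightarrow> 'q) \<Rightarrow> bool" where
  "Ck_map k \<A> \<B> W f \<longleftrightarrow> continuous_on W f \<and>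
     (\<forall>c\<in>\<A>. \<forall>d\<in>\<B>. Ck_on k (snd d \<circ> f \<circ> chart_inv c) (snd c ` (fst c \<inter> W \<inter> f -` fst d)))"

definition smooth_map ::
  "('p::topological_space, 'e::euclidean_space) chart set \<Rightarrow>
     ('q::topological_space, 'f::euclidean_space) chart set \<Rightarrow> 'p set \<Rightarrow> ('p \<Rightarrow> 'q) \<Rightarrow> bool" where
  "smooth_map \<A> \<B> W f \<longleftrightarrow> (\<forall>k. Ck_map k \<A> \<B> W f)"

definition euclid_atlas :: "('e::euclidean_space, 'e) chart set" where
  "euclid_atlas = {(UNIV, id)}"

definition prod_atlas ::
  "('p, 'e) chart set \<Rightarrow> ('q, 'f) chart set \<Rightarrow> ('p \<times> 'q, 'e \<times> 'f) chart set" where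
  "prod_atlas \<A> \<B> = {(fst c \<times> fst d, map_prod (snd c) (snd d)) |c d. c \<in> \<A> \<and> d \<in> \<B>}"

definition diffeomorphism_on ::
  "('p::topological_space, 'e::euclidean_space) chart set \<Rightarrow>
     ('q::topological_space, 'f::euclidean_space) chart set \<Rightarrow>
     'p set \<Rightarrow> 'q set \<Rightarrow> ('p \<Rightarrow> 'q) \<Rightarrow> bool" where
  "diffeomorphism_on \<A> \<B> S T f \<longleftrightarrow>
     bij_betw f S T \<and> smooth_map \<A> \<B> S f \<and> smooth_map \<B> \<A> T (inv_into S f)"

text \<open>Each point \<open>p\<close> gets a preferred chart, and the tangent space at \<open>p\<close> is modelled by \<open>'e\<close>,
  a tangent vector being given by its components in the preferred chart. \<open>push \<A> c p v\<close> are
  the components of \<open>v\<close> in the chart \<open>c\<close> (that is, the differential at \<open>p\<close> of the coordinate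
  map of \<open>c\<close> applied to \<open>v\<close>), and \<open>coord_field \<A> c u\<close> is the vector field on the domain of
  \<open>c\<close> with constant components \<open>u\<close> in \<open>c\<close>.\<close>

definition chart_at :: "('p, 'e) chart set \<Rightarrow> 'p \<Rightarrow> ('p, 'e) chart" where
  "chart_at \<A> p = (SOME c. c \<in> \<A> \<and> p \<in> fst c)"

definition push ::
  "('p, 'e::euclidean_space) chart set \<Rightarrow> ('p, 'e) chart \<Rightarrow> 'p \<Rightarrow> 'e \<Rightarrow> 'e" where
  "push \<A> c p v =
     frechet_derivative (snd c \<circ> chart_inv (chart_at \<A> p)) (at (snd (chart_at \<A> p) p)) v"

definition coord_field ::
  "('p, 'e::euclidean_space) chart set \<Rightarrow> ('p, 'e) chart \<Rightarrow> 'e \<Rightarrow> 'p \<Rightarrow> 'e" where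
  "coord_field \<A> c u p = frechet_derivative (snd (chart_at \<A> p) \<circ> chart_inv c) (at (snd c p)) u"

definition field_rep ::
  "('p, 'e::euclidean_space) chart set \<Rightarrow> ('p, 'e) chart \<Rightarrow> ('p \<Rightarrow> 'e) \<Rightarrow> 'e \<Rightarrow> 'e" where
  "field_rep \<A> c X x = push \<A> c (chart_inv c x) (X (chart_inv c x))"

definition smooth_field ::
  "('p, 'e::euclidean_space) chart set \<Rightarrow> 'p set \<Rightarrow> ('p \<Rightarrow> 'e) \<Rightarrow> bool" where
  "smooth_field \<A> U X \<longleftrightarrow> (\<forall>c\<in>\<A>. smooth_on (snd c ` (fst c \<inter> U)) (field_rep \<A> c X))"

definition smooth_fun ::
  "('p::topological_space, 'e::euclidean_space) chart set \<Rightarrow> 'p set \<Rightarrow> ('p \<Rightarrow> real) \<Rightarrow> bool" where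
  "smooth_fun \<A> U f \<longleftrightarrow> smooth_map \<A> euclid_atlas U f"

definition dir_deriv ::
  "('p, 'e::euclidean_space) chart set \<Rightarrow> 'p \<Rightarrow> 'e \<Rightarrow> ('p \<Rightarrow> real) \<Rightarrow> real" where
  "dir_deriv \<A> p v f =
     frechet_derivative (f \<circ> chart_inv (chart_at \<A> p)) (at (snd (chart_at \<A> p) p)) v"

definition lie_bracket ::
  "('p, 'e::euclidean_space) chart set \<Rightarrow> ('p \<Rightarrow> 'e) \<Rightarrow> ('p \<Rightarrow> 'e) \<Rightarrow> 'p \<Rightarrow> 'e" where
  "lie_bracket \<A> X Y p =
     (let c = chart_at \<A> p; x = snd c p in
        frechet_derivative (field_rep \<A> c Y) (at x) (X p) -
        frechet_derivative (field_rep \<A> c X) (at x) (Y p))"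

definition riemannian_manifold ::
  "('p::topological_space, 'e::euclidean_space) chart set \<Rightarrow> ('p \<Rightarrow> 'e \<Rightarrow> 'e \<Rightarrow> real) \<Rightarrow> bool" where
  "riemannian_manifold \<A> g \<longleftrightarrow>
     smooth_structure \<A> \<and>
     (\<forall>p. bilinear (g p) \<and> (\<forall>u v. g p u v = g p v u) \<and> (\<forall>v. v \<noteq> 0 \<longrightarrow> g p v v > 0)) \<and>
     (\<forall>U X Y. open U \<and> smooth_field \<A> U X \<and> smooth_field \<A> U Y \<longrightarrow>
        smooth_fun \<A> U (\<lambda>p. g p (X p) (Y p)))"

text \<open>A connection \<open>nab\<close> is regarded as acting on local vector fields: \<open>nab p v Y\<close> is the
  covariant derivative at \<open>p\<close>, in the direction of the tangent vector \<open>v\<close> at \<open>p\<close>, of a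
  field \<open>Y\<close> that is smooth near \<open>p\<close>. The locality clause makes this the same
  datum as a Koszul connection on global vector fields. No torsion condition is imposed.\<close>

definition affine_connection ::
  "('p::topological_space, 'e::euclidean_space) chart set \<Rightarrow>
     ('p \<Rightarrow> 'e \<Rightarrow> ('p \<Rightarrow> 'e) \<Rightarrow> 'e) \<Rightarrow> bool" where
  "affine_connection \<A> nab \<longleftrightarrow>
     (\<forall>U p Y. open U \<and> p \<in> U \<and> smooth_field \<A> U Y \<longrightarrow>
        linear (\<lambda>v. nab p v Y) \<and>
        (\<forall>v Z. smooth_field \<A> U Z \<longrightarrow> nab p v (\<lambda>q. Y q + Z q) = nab p v Y + nab p v Z) \<and>
        (\<forall>v f. smooth_fun \<A> U f \<longrightarrow>
           nab p v (\<lambda>q. f q *\<^sub>R Y q) = dir_deriv \<A> p v f *\<^sub>R Y p + f p *\<^sub>R nab p v Y) \<and>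
        (\<forall>v Z. (\<forall>q\<in>U. Z q = Y q) \<longrightarrow> nab p v Z = nab p v Y)) \<and>
     (\<forall>U X Y. open U \<and> smooth_field \<A> U X \<and> smooth_field \<A> U Y \<longrightarrow>
        smooth_field \<A> U (\<lambda>p. nab p (X p) Y))"

definition dual_connection ::
  "('p::topological_space, 'e::euclidean_space) chart set \<Rightarrow> ('p \<Rightarrow> 'e \<Rightarrow> 'e \<Rightarrow> real) \<Rightarrow>
     ('p \<Rightarrow> 'e \<Rightarrow> ('p \<Rightarrow> 'e) \<Rightarrow> 'e) \<Rightarrow> ('p \<Rightarrow> 'e \<Rightarrow> ('p \<Rightarrow> 'e) \<Rightarrow> 'e) \<Rightarrow> bool" where
  "dual_connection \<A> g nab nab' \<longleftrightarrow>
     (\<forall>U X Y Z. open U \<and> smooth_field \<A> U X \<and> smooth_field \<A> U Y \<and> smooth_field \<A> U Z \<longrightarrow>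
        (\<forall>p\<in>U. dir_deriv \<A> p (X p) (\<lambda>q. g q (Y q) (Z q)) =
           g p (nab p (X p) Y) (Z p) + g p (Y p) (nab' p (X p) Z)))"

definition torsion_free ::
  "('p::topological_space, 'e::euclidean_space) chart set \<Rightarrow>
     ('p \<Rightarrow> 'e \<Rightarrow> ('p \<Rightarrow> 'e) \<Rightarrow> 'e) \<Rightarrow> bool" where
  "torsion_free \<A> nab \<longleftrightarrow>
     (\<forall>U X Y. open U \<and> smooth_field \<A> U X \<and> smooth_field \<A> U Y \<longrightarrow>
        (\<forall>p\<in>U. nab p (X p) Y - nab p (Y p) X = lie_bracket \<A> X Y p))"

text \<open>Being metric is the same as being self-dual.\<close>

definition levi_civita ::
  "('p::topological_space, 'e::euclidean_space) chart set \<Rightarrow> ('p \<Rightarrow> 'e \<Rightarrow> 'e \<Rightarrow> real) \<Rightarrow>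
     ('p \<Rightarrow> 'e \<Rightarrow> ('p \<Rightarrow> 'e) \<Rightarrow> 'e) \<Rightarrow> bool" where
  "levi_civita \<A> g nab \<longleftrightarrow>
     affine_connection \<A> nab \<and> dual_connection \<A> g nab nab \<and> torsion_free \<A> nab"

definition C1_curve ::
  "('p::topological_space, 'e::euclidean_space) chart set \<Rightarrow> real \<Rightarrow> real \<Rightarrow> (real \<Rightarrow> 'p) \<Rightarrow> bool" where
  "C1_curve \<A> a b \<gamma> \<longleftrightarrow> continuous_on {a..b} \<gamma> \<and>
     (\<forall>c\<in>\<A>. \<exists>w. continuous_on ({a..b} \<inter> \<gamma> -` fst c) w \<and>
        (\<forall>t\<in>{a..b} \<inter> \<gamma> -` fst c. (snd c \<circ> \<gamma> has_vector_derivative w t) (at t within {a..b})))"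

definition piecewise_C1_curve ::
  "('p::topological_space, 'e::euclidean_space) chart set \<Rightarrow> real \<Rightarrow> real \<Rightarrow> (real \<Rightarrow> 'p) \<Rightarrow> bool" where
  "piecewise_C1_curve \<A> a b \<gamma> \<longleftrightarrow>
     (\<exists>n \<tau>. \<tau> 0 = a \<and> \<tau> n = b \<and> (\<forall>i<n. \<tau> i < \<tau> (Suc i) \<and> C1_curve \<A> (\<tau> i) (\<tau> (Suc i)) \<gamma>))"

definition velocity ::
  "('p, 'e::euclidean_space) chart set \<Rightarrow> real set \<Rightarrow> (real \<Rightarrow> 'p) \<Rightarrow> real \<Rightarrow> 'e" where
  "velocity \<A> I \<gamma> t = vector_derivative (snd (chart_at \<A> (\<gamma> t)) \<circ> \<gamma>) (at t within I)"

text \<open>For a piecewise \<open>C\<^sup>1\<close> curve the velocity is meaningful except at finitely many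
  parameters, which the integral does not see.\<close>

definition curve_length ::
  "('p, 'e::euclidean_space) chart set \<Rightarrow> ('p \<Rightarrow> 'e \<Rightarrow> 'e \<Rightarrow> real) \<Rightarrow>
     real \<Rightarrow> real \<Rightarrow> (real \<Rightarrow> 'p) \<Rightarrow> real" where
  "curve_length \<A> g a b \<gamma> =
     integral {a..b}
       (\<lambda>t. sqrt (g (\<gamma> t) (velocity \<A> {a..b} \<gamma> t) (velocity \<A> {a..b} \<gamma> t)))"

text \<open>The infimum is over a nonempty set whenever \<open>P\<close> and \<open>Q\<close> lie in the same component;
  connectedness of the manifold is not required, and below the distance is used only
  inside a strongly convex set. The value for points in different components (infinity in
  the usual convention) is unspecified.\<close>

definition riem_dist ::
  "('p::topological_space, 'e::euclidean_space) chart set \<Rightarrow> ('p \<Rightarrow> 'e \<Rightarrow> 'e \<Rightarrow> real) \<Rightarrow>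
     'p \<Rightarrow> 'p \<Rightarrow> real" where
  "riem_dist \<A> g P Q =
     Inf {curve_length \<A> g a b \<gamma> |a b \<gamma>.
            a < b \<and> piecewise_C1_curve \<A> a b \<gamma> \<and> \<gamma> a = P \<and> \<gamma> b = Q}"

definition christoffel ::
  "('p, 'e::euclidean_space) chart set \<Rightarrow> ('p \<Rightarrow> 'e \<Rightarrow> ('p \<Rightarrow> 'e) \<Rightarrow> 'e) \<Rightarrow>
     ('p, 'e) chart \<Rightarrow> 'p \<Rightarrow> 'e \<Rightarrow> 'e \<Rightarrow> 'e" where
  "christoffel \<A> nab c p u v = push \<A> c p (nab p (coord_field \<A> c u p) (coord_field \<A> c v))"

text \<open>Affinely parametrized geodesics on \<open>[0,1]\<close>: the equation \<open>\<nabla>\<^sub>\<gamma>\<^sub>' \<gamma>' = 0\<close>, written as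
  \<open>x'' + \<Gamma>(x)(x', x') = 0\<close> in every chart; \<open>w\<close> is the velocity \<open>x'\<close> in the chart \<open>c\<close>.
  Constant curves are included.\<close>

definition geodesic ::
  "('p::topological_space, 'e::euclidean_space) chart set \<Rightarrow>
     ('p \<Rightarrow> 'e \<Rightarrow> ('p \<Rightarrow> 'e) \<Rightarrow> 'e) \<Rightarrow> (real \<Rightarrow> 'p) \<Rightarrow> bool" where
  "geodesic \<A> nab \<gamma> \<longleftrightarrow> continuous_on {0..1} \<gamma> \<and>
     (\<forall>c\<in>\<A>. \<exists>w. \<forall>t\<in>{0..1} \<inter> \<gamma> -` fst c.
        (snd c \<circ> \<gamma> has_vector_derivative w t) (at t within {0..1}) \<and>
        (w has_vector_derivative - christoffel \<A> nab c (\<gamma> t) (w t) (w t)) (at t within {0..1}))"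

definition geodesic_segment ::
  "('p::topological_space, 'e::euclidean_space) chart set \<Rightarrow>
     ('p \<Rightarrow> 'e \<Rightarrow> ('p \<Rightarrow> 'e) \<Rightarrow> 'e) \<Rightarrow> 'p set \<Rightarrow> 'p \<Rightarrow> 'p \<Rightarrow> (real \<Rightarrow> 'p) \<Rightarrow> bool" where
  "geodesic_segment \<A> nab S P Q \<gamma> \<longleftrightarrow>
     geodesic \<A> nab \<gamma> \<and> \<gamma> 0 = P \<and> \<gamma> 1 = Q \<and> \<gamma> ` {0..1} \<subseteq> S"

definition minimizing_segment ::
  "('p::topological_space, 'e::euclidean_space) chart set \<Rightarrow> ('p \<Rightarrow> 'e \<Rightarrow> 'e \<Rightarrow> real) \<Rightarrow>
     ('p \<Rightarrow> 'e \<Rightarrow> ('p \<Rightarrow> 'e) \<Rightarrow> 'e) \<Rightarrow> 'p \<Rightarrow> 'p \<Rightarrow> (real \<Rightarrow> 'p) \<Rightarrow> bool" where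
  "minimizing_segment \<A> g nabg P Q \<gamma> \<longleftrightarrow>
     geodesic_segment \<A> nabg UNIV P Q \<gamma> \<and> curve_length \<A> g 0 1 \<gamma> = riem_dist \<A> g P Q"

text \<open>Uniqueness of a curve on \<open>[0,1]\<close>; values at other parameters are irrelevant.\<close>

definition unique_curve :: "((real \<Rightarrow> 'p) \<Rightarrow> bool) \<Rightarrow> bool" where
  "unique_curve \<Phi> \<longleftrightarrow> (\<exists>\<gamma>. \<Phi> \<gamma> \<and> (\<forall>\<gamma>'. \<Phi> \<gamma>' \<longrightarrow> (\<forall>t\<in>{0..1}. \<gamma>' t = \<gamma> t)))"

definition curve_midpoint :: "((real \<Rightarrow> 'p) \<Rightarrow> bool) \<Rightarrow> 'p" where
  "curve_midpoint \<Phi> = (THE m. \<exists>\<gamma>. \<Phi> \<gamma> \<and> m = \<gamma> (1/2))"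

text \<open>Midpoint map of a connection, using geodesic segments contained in \<open>S\<close>. The two cases of
  interest are \<open>S = UNIV\<close> (uniqueness in the ambient manifold) and \<open>S\<close> a convex normal
  neighborhood.\<close>

definition midpoint_map ::
  "('p::topological_space, 'e::euclidean_space) chart set \<Rightarrow>
     ('p \<Rightarrow> 'e \<Rightarrow> ('p \<Rightarrow> 'e) \<Rightarrow> 'e) \<Rightarrow> 'p set \<Rightarrow> 'p \<times> 'p \<Rightarrow> 'p" where
  "midpoint_map \<A> nab S = (\<lambda>(P, Q). curve_midpoint (geodesic_segment \<A> nab S P Q))"

definition midpoint_uniquely_defined ::
  "('p::topological_space, 'e::euclidean_space) chart set \<Rightarrow>
     ('p \<Rightarrow> 'e \<Rightarrow> ('p \<Rightarrow> 'e) \<Rightarrow> 'e) \<Rightarrow> 'p set \<Rightarrow> ('p \<times> 'p) set \<Rightarrow> bool" where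
  "midpoint_uniquely_defined \<A> nab S W \<longleftrightarrow>
     (\<forall>(P, Q)\<in>W. unique_curve (geodesic_segment \<A> nab S P Q))"

definition min_midpoint_map ::
  "('p::topological_space, 'e::euclidean_space) chart set \<Rightarrow> ('p \<Rightarrow> 'e \<Rightarrow> 'e \<Rightarrow> real) \<Rightarrow>
     ('p \<Rightarrow> 'e \<Rightarrow> ('p \<Rightarrow> 'e) \<Rightarrow> 'e) \<Rightarrow> 'p \<times> 'p \<Rightarrow> 'p" where
  "min_midpoint_map \<A> g nabg = (\<lambda>(P, Q). curve_midpoint (minimizing_segment \<A> g nabg P Q))"

definition exp_curve ::
  "('p::topological_space, 'e::euclidean_space) chart set \<Rightarrow>
     ('p \<Rightarrow> 'e \<Rightarrow> ('p \<Rightarrow> 'e) \<Rightarrow> 'e) \<Rightarrow> 'p \<Rightarrow> 'e \<Rightarrow> (real \<Rightarrow> 'p) \<Rightarrow> bool" where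
  "exp_curve \<A> nab p v \<gamma> \<longleftrightarrow> geodesic \<A> nab \<gamma> \<and> \<gamma> 0 = p \<and> velocity \<A> {0..1} \<gamma> 0 = v"

definition exp_domain ::
  "('p::topological_space, 'e::euclidean_space) chart set \<Rightarrow>
     ('p \<Rightarrow> 'e \<Rightarrow> ('p \<Rightarrow> 'e) \<Rightarrow> 'e) \<Rightarrow> 'p \<Rightarrow> 'e set" where
  "exp_domain \<A> nab p = {v. \<exists>\<gamma>. exp_curve \<A> nab p v \<gamma>}"

definition exp_map ::
  "('p::topological_space, 'e::euclidean_space) chart set \<Rightarrow>
     ('p \<Rightarrow> 'e \<Rightarrow> ('p \<Rightarrow> 'e) \<Rightarrow> 'e) \<Rightarrow> 'p \<Rightarrow> 'e \<Rightarrow> 'p" where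
  "exp_map \<A> nab p v = (THE q. \<exists>\<gamma>. exp_curve \<A> nab p v \<gamma> \<and> q = \<gamma> 1)"

definition normal_neighborhood ::
  "('p::topological_space, 'e::euclidean_space) chart set \<Rightarrow>
     ('p \<Rightarrow> 'e \<Rightarrow> ('p \<Rightarrow> 'e) \<Rightarrow> 'e) \<Rightarrow> 'p \<Rightarrow> 'p set \<Rightarrow> bool" where
  "normal_neighborhood \<A> nabg p V \<longleftrightarrow> open V \<and> p \<in> V \<and>
     (\<exists>S. open S \<and> 0 \<in> S \<and> (\<forall>v\<in>S. closed_segment 0 v \<subseteq> S) \<and> S \<subseteq> exp_domain \<A> nabg p \<and>
        diffeomorphism_on euclid_atlas \<A> S V (exp_map \<A> nabg p))"

definition strongly_convex ::
  "('p::topological_space, 'e::euclidean_space) chart set \<Rightarrow> ('p \<Rightarrow> 'e \<Rightarrow> 'e \<Rightarrow> real) \<Rightarrow>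
     ('p \<Rightarrow> 'e \<Rightarrow> ('p \<Rightarrow> 'e) \<Rightarrow> 'e) \<Rightarrow> 'p set \<Rightarrow> bool" where
  "strongly_convex \<A> g nabg V \<longleftrightarrow>
     (\<forall>P\<in>V. \<forall>Q\<in>V. unique_curve (minimizing_segment \<A> g nabg P Q) \<and>
        (\<forall>\<gamma>. minimizing_segment \<A> g nabg P Q \<gamma> \<longrightarrow> \<gamma> ` {0..1} \<subseteq> V))"

definition mean_step :: "('p \<times> 'p \<Rightarrow> 'p) \<Rightarrow> ('p \<times> 'p \<Rightarrow> 'p) \<Rightarrow> 'p \<times> 'p \<Rightarrow> 'p \<times> 'p" where
  "mean_step A M z = (A z, M z)"

definition mean_iter ::
  "('p \<times> 'p \<Rightarrow> 'p) \<Rightarrow> ('p \<times> 'p \<Rightarrow> 'p) \<Rightarrow> 'p \<times> 'p \<Rightarrow> nat \<Rightarrow> 'p \<times> 'p" where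
  "mean_iter A M z n = (mean_step A M ^^ n) z"

definition gauss_limit ::
  "('p::topological_space \<times> 'p \<Rightarrow> 'p) \<Rightarrow> ('p \<times> 'p \<Rightarrow> 'p) \<Rightarrow> 'p \<times> 'p \<Rightarrow> 'p \<Rightarrow> bool" where
  "gauss_limit A M z l \<longleftrightarrow>
     (\<lambda>n. fst (mean_iter A M z n)) \<longlonglongrightarrow> l \<and> (\<lambda>n. snd (mean_iter A M z n)) \<longlonglongrightarrow> l"

definition gauss_comp ::
  "('p::topological_space \<times> 'p \<Rightarrow> 'p) \<Rightarrow> ('p \<times> 'p \<Rightarrow> 'p) \<Rightarrow> 'p \<times> 'p \<Rightarrow> 'p" where
  "gauss_comp A M z = (THE l. gauss_limit A M z l)"

definition coord_dist :: "('p, 'e::real_normed_vector) chart \<Rightarrow> 'p \<Rightarrow> 'p \<Rightarrow> real" where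
  "coord_dist c X Y = norm (snd c X - snd c Y)"

definition convergence_data ::
  "('p::topological_space, 'e::euclidean_space) chart \<Rightarrow> 'p \<Rightarrow> ('p \<times> 'p) set \<Rightarrow>
     ('p \<times> 'p \<Rightarrow> 'p) \<Rightarrow> ('p \<times> 'p \<Rightarrow> 'p) \<Rightarrow>
     'p set \<Rightarrow> 'p set \<Rightarrow> ('p \<times> 'p) set \<Rightarrow> real \<Rightarrow> real \<Rightarrow> bool" where
  "convergence_data c p W A M K U D \<epsilon> C \<longleftrightarrow>
     compact K \<and> K \<subseteq> fst c \<and> K \<times> K \<subseteq> W \<and>
     open U \<and> p \<in> U \<and> U \<subseteq> K \<and>
     open D \<and> prod.swap ` D \<subseteq> D \<and> mean_step A M ` D \<subseteq> D \<and> D \<subseteq> K \<times> K \<and>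
     0 < \<epsilon> \<and> 0 < C \<and>
     {(X, Y). X \<in> U \<and> Y \<in> U \<and> coord_dist c X Y < \<epsilon>} \<subseteq> D \<and>
     (\<exists>L.
       (\<forall>z\<in>D. L z \<in> K \<and> gauss_limit A M z (L z) \<and>
          (\<forall>n P Q P' Q'. mean_iter A M z n = (P, Q) \<and> mean_iter A M z (Suc n) = (P', Q') \<longrightarrow>
             (P, Q) \<in> D \<and>
             coord_dist c P' Q' \<le> C * (coord_dist c P Q)\<^sup>2 \<and>
             C * (coord_dist c P Q)\<^sup>2 \<le> 1/2 * coord_dist c P Q \<and>
             coord_dist c P (L z) \<le> 2 * coord_dist c P Q \<and>
             coord_dist c Q (L z) \<le> 3 * coord_dist c P Q)) \<and>
       continuous_on D L \<and>
       (\<forall>X Y. (X, Y) \<in> D \<longrightarrow> L (Y, X) = L (X, Y)) \<and>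
       (\<forall>X. (X, X) \<in> D \<longrightarrow> L (X, X) = X) \<and>
       (\<forall>X Y. (X, Y) \<in> D \<longrightarrow>
          norm (snd c (L (X, Y)) - (1/2) *\<^sub>R (snd c (A (X, Y)) + snd c (M (X, Y))))
            \<le> 2/3 * C^3 * (coord_dist c X Y)^4))"

end

theory Submission
  imports Defs
begin

text \<open>The invariance \<open>M\<^sub>g(A(X, Y), M(X, Y)) = M\<^sub>g(X, Y)\<close> propagates along the iteration, so all
  pairs \<open>(P\<^sub>n, Q\<^sub>n)\<close> have one common Riemannian midpoint \<open>m = M\<^sub>g(P\<^sub>0, Q\<^sub>0)\<close>
  (\<open>mean_iter_invariant\<close>). A Riemannian midpoint is at half the distance from either end point
  (\<open>dist_mid\<close>), which is the last assertion of the theorem. It also locates the limit \<open>L\<close> of the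
  iteration: by the triangle inequality \<open>d(L, m) \<le> d(L, P\<^sub>n) + \<delta>\<^sub>n / 2\<close>, and the right-hand side
  tends to \<open>0\<close> because coordinate convergence implies convergence in distance. As the distance
  separates the points of \<open>\<V>\<close> (\<open>dist_zeroD\<close>), \<open>L = m\<close>. Finally, the quadratic rate is known for the
  coordinate distance, and on the compact set \<open>\<K>\<close> the two distances are equivalent
  (\<open>dist_comparable\<close>), so it carries over to \<open>\<delta>\<close>.

  The facts about the Riemannian distance come from three sources. Geodesics of a metric connection
  have constant speed (\<open>metric_geodesic_constant_speed\<close>); since any two points of \<open>\<V>\<close> are joined by
  a minimizing geodesic, lengths reduce to speed times time, and the triangle inequality, symmetry
  and the halving property follow by joining, reversing and restricting such segments. Distances
  are bounded above by the lengths of segments that are straight in a chart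
  (\<open>riem_dist_le_straight\<close>). They are bounded below because a short segment cannot leave a coordinate
  ball (\<open>short_curve_stays_in_chart_ball\<close>). To calculate with curves and fields in a single chart, one
  needs the chain rule for maps of class \<open>C\<^sup>k\<close> and the cocycle identity of the coordinate changes.\<close>

section \<open>Calculus of maps of class C^k\<close>

lemma Ck_on_cong:
  assumes "open S" "Ck_on k f S" "\<And>x. x \<in> S \<Longrightarrow> f x = h x"
  shows "Ck_on k h S"
  using assms(2,3)
proof (induction k arbitrary: f h)
  case 0 then show ?case by (auto cong: continuous_on_cong)
next
  case (Suc k)
  have D: "(h has_derivative frechet_derivative f (at x)) (at x)" if "x \<in> S" for x
  proof -
    have "(f has_derivative frechet_derivative f (at x)) (at x)"
      using Suc.prems(1) that assms(1)
      by (simp add: differentiable_on_eq_differentiable_at frechet_derivative_works)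
    then show ?thesis
      by (rule has_derivative_transform_within_open[OF _ assms(1) that Suc.prems(2)])
  qed
  have "h differentiable_on S"
    using D assms(1) by (auto simp: differentiable_on_eq_differentiable_at differentiable_def)
  moreover have "Ck_on k (\<lambda>x. frechet_derivative h (at x) v) S" for v
    by (rule Suc.IH[of "\<lambda>x. frechet_derivative f (at x) v"])
      (use Suc.prems(1) D frechet_derivative_at in \<open>fastforce+\<close>)
  ultimately show ?case by simp
qed

text \<open>The inductive definition speaks of the chosen derivative \<open>frechet_derivative\<close>; this
  introduction rule accepts any explicit formula for the derivative.\<close>

lemma Ck_on_SucI:
  assumes "open S" "\<And>x. x \<in> S \<Longrightarrow> (f has_derivative f' x) (at x)"
    "\<And>v. Ck_on k (\<lambda>x. f' x v) S"
  shows "Ck_on (Suc k) f S"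
proof -
  have "f differentiable_on S"
    using assms(1,2) by (auto simp: differentiable_on_eq_differentiable_at differentiable_def)
  moreover have "Ck_on k (\<lambda>x. frechet_derivative f (at x) v) S" for v
    by (rule Ck_on_cong[OF assms(1) assms(3)[of v]])
        (simp add: frechet_derivative_at[OF assms(2), symmetric])
  ultimately show ?thesis by simp
qed

lemma Ck_on_SucD:
  assumes "Ck_on (Suc k) f S" "open S" "x \<in> S"
  shows "(f has_derivative frechet_derivative f (at x)) (at x)"
  using assms by (simp add: differentiable_on_eq_differentiable_at frechet_derivative_works)

lemma Ck_on_Suc_imp: "Ck_on (Suc k) f S \<Longrightarrow> Ck_on k f S"
proof (induction k arbitrary: f)
  case 0 then show ?case by (simp add: differentiable_imp_continuous_on)
next
  case (Suc k)
  show ?case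
    unfolding Ck_on.simps(2)[of k] using Suc.prems by (auto intro!: Suc.IH)
qed

lemma Ck_on_const: "open S \<Longrightarrow> Ck_on k (\<lambda>x. a) S"
proof (induction k arbitrary: a)
  case (Suc k) then show ?case by (intro Ck_on_SucI[where f'="\<lambda>_ _. 0"]) auto
qed simp

lemma Ck_on_add: "open S \<Longrightarrow> Ck_on k f S \<Longrightarrow> Ck_on k h S \<Longrightarrow> Ck_on k (\<lambda>x. f x + h x) S"
proof (induction k arbitrary: f h)
  case 0 then show ?case by (simp add: continuous_on_add)
next
  case (Suc k)
  show ?case
    by (rule Ck_on_SucI[OF Suc.prems(1)
        has_derivative_add[OF Ck_on_SucD[OF Suc.prems(2,1)] Ck_on_SucD[OF Suc.prems(3,1)]]])
      (use Suc in auto)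
qed

lemma Ck_on_sum:
  assumes "open S" "\<And>i. i \<in> I \<Longrightarrow> Ck_on k (f i) S"
  shows "Ck_on k (\<lambda>x. \<Sum>i\<in>I. f i x) S"
  using assms(2)
proof (induction I rule: infinite_finite_induct)
  case (insert i I)
  then show ?case by (simp add: Ck_on_add[OF assms(1)])
qed (simp_all add: Ck_on_const[OF assms(1)])

lemma Ck_on_scaleR:
  fixes f :: "'a::euclidean_space \<Rightarrow> real"
  shows "open S \<Longrightarrow> Ck_on k f S \<Longrightarrow> Ck_on k h S \<Longrightarrow> Ck_on k (\<lambda>x. f x *\<^sub>R h x) S"
proof (induction k arbitrary: f h)
  case 0 then show ?case by (simp add: continuous_on_scaleR)
next
  case (Suc k)
  note f = Suc.prems(2) and h = Suc.prems(3) and S = Suc.prems(1)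
  show ?case
  proof (rule Ck_on_SucI[OF S has_derivative_scaleR[OF Ck_on_SucD[OF f S] Ck_on_SucD[OF h S]]])
    show "Ck_on k (\<lambda>x. f x *\<^sub>R frechet_derivative h (at x) v + frechet_derivative f
        (at x) v *\<^sub>R h x) S" for v
      using f h Ck_on_Suc_imp[OF f] Ck_on_Suc_imp[OF h] by (intro Ck_on_add Suc.IH S) auto
  qed
qed

lemma Ck_on_bounded_linear:
  assumes "bounded_linear l"
  shows "open S \<Longrightarrow> Ck_on k f S \<Longrightarrow> Ck_on k (\<lambda>x. l (f x)) S"
proof (induction k arbitrary: f)
  case 0 then show ?case by (simp add: bounded_linear.continuous_on[OF assms])
next
  case (Suc k)
  show ?case
    by (rule Ck_on_SucI[OF Suc.prems(1) bounded_linear.has_derivative[OF assms Ck_on_SucD[OF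
        Suc.prems(2,1)]]])
      (use Suc in auto)
qed

lemma linear_sum_Basis:
  fixes f :: "'a::euclidean_space \<Rightarrow> 'b::real_vector"
  assumes "linear f"
  shows "f x = (\<Sum>i\<in>Basis. (x \<bullet> i) *\<^sub>R f i)"
proof -
  have "f x = f (\<Sum>i\<in>Basis. (x \<bullet> i) *\<^sub>R i)" by (simp add: euclidean_representation)
  also have "\<dots> = (\<Sum>i\<in>Basis. (x \<bullet> i) *\<^sub>R f i)"
    by (simp add: linear_sum[OF assms] linear_scale[OF assms])
  finally show ?thesis .
qed

text \<open>Induction on the order: by the chain rule a directional derivative of \<open>f \<circ> h\<close> is
  \<open>\<Sum>\<^sub>i \<langle>h'(x)v, e\<^sub>i\<rangle> (\<partial>\<^sub>i f)(h x)\<close>, and the induction hypothesis applies to each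
  \<open>\<partial>\<^sub>i f \<circ> h\<close>.\<close>

lemma Ck_on_compose:
  fixes h :: "'a::euclidean_space \<Rightarrow> 'b::euclidean_space"
  assumes S: "open S" and T: "open T" and hST: "h ` S \<subseteq> T"
  shows "Ck_on k f T \<Longrightarrow> Ck_on k h S \<Longrightarrow> Ck_on k (f \<circ> h) S"
proof (induction k arbitrary: f)
  case 0 then show ?case using hST by (auto intro: continuous_on_compose2)
next
  case (Suc k)
  note f = Suc.prems(1) and h = Suc.prems(2)
  have D: "(f \<circ> h has_derivative frechet_derivative f (at (h x)) \<circ> frechet_derivative h (at x)) (at x)"
    if "x \<in> S" for x
    using Ck_on_SucD[OF f T, of "h x"] Ck_on_SucD[OF h S that] hST that
    by (intro diff_chain_at) auto
  show ?case
  proof (rule Ck_on_SucI[OF S D])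
    fix v
    have "Ck_on k (\<lambda>x. \<Sum>i\<in>Basis. (frechet_derivative h (at x) v \<bullet> i) *\<^sub>R
              ((\<lambda>y. frechet_derivative f (at y) i) \<circ> h) x) S"
      using f h S
      by (intro Ck_on_sum Ck_on_scaleR Ck_on_bounded_linear[OF bounded_linear_inner_left] Suc.IH
          Ck_on_Suc_imp[OF h]) auto
    then show "Ck_on k (\<lambda>x. (frechet_derivative f (at (h x)) \<circ> frechet_derivative h (at x)) v) S"
    proof (rule Ck_on_cong[OF S])
      fix x assume "x \<in> S"
      then have "linear (frechet_derivative f (at (h x)))"
        using Ck_on_SucD[OF f T, THEN has_derivative_linear] hST by blast
      from linear_sum_Basis[OF this, symmetric] show "(\<Sum>i\<in>Basis. (frechet_derivative h (at x) v \<bullet> i) *\<^sub>R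
              ((\<lambda>y. frechet_derivative f (at y) i) \<circ> h) x) = (frechet_derivative f
                  (at (h x)) \<circ> frechet_derivative h (at x)) v"
        by (simp only: comp_apply)
    qed
  qed
qed

section \<open>Charts and tangent vectors\<close>

locale smooth_mfd =
  fixes \<A> :: "('p::t2_space, 'e::euclidean_space) chart set"
  assumes smooth_structure: "smooth_structure \<A>"
begin

lemma chartD:
  assumes "c \<in> \<A>"
  shows "open (fst c)" "open (snd c ` fst c)"
    "homeomorphism (fst c) (snd c ` fst c) (snd c) (chart_inv c)"
  using assms smooth_structure by (auto simp: smooth_structure_def is_chart_def)

lemma chart_inv_left: "c \<in> \<A> \<Longrightarrow> p \<in> fst c \<Longrightarrow> chart_inv c (snd c p) = p"
  using chartD(3) by (auto simp: homeomorphism_def)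

lemma chart_inv_right:
  assumes "c \<in> \<A>" "x \<in> snd c ` fst c"
  shows "snd c (chart_inv c x) = x" "chart_inv c x \<in> fst c"
  using chartD(3)[OF assms(1)] assms(2) by (auto simp: homeomorphism_def)

lemma continuous_chart: "c \<in> \<A> \<Longrightarrow> continuous_on (fst c) (snd c)"
  using chartD(3) by (auto simp: homeomorphism_def)

lemma continuous_chart_inv: "c \<in> \<A> \<Longrightarrow> continuous_on (snd c ` fst c) (chart_inv c)"
  using chartD(3) by (auto simp: homeomorphism_def)

lemma open_chart_image:
  assumes "c \<in> \<A>" "open U"
  shows "open (snd c ` (fst c \<inter> U))"
proof -
  have "snd c ` (fst c \<inter> U) = chart_inv c -` U \<inter> snd c ` fst c"
    using chart_inv_left[OF assms(1)] by force
  then show ?thesis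
    using continuous_on_open_vimage[OF chartD(2)[OF assms(1)], of "chart_inv c"]
      continuous_chart_inv[OF assms(1)] assms(2) by simp
qed

lemma chart_at: "chart_at \<A> p \<in> \<A>" "p \<in> fst (chart_at \<A> p)"
proof -
  have "p \<in> (\<Union>c\<in>\<A>. fst c)"
    using smooth_structure unfolding smooth_structure_def by blast
  then have "\<exists>c. c \<in> \<A> \<and> p \<in> fst c" by blast
  from someI_ex[OF this] show "chart_at \<A> p \<in> \<A>" "p \<in> fst (chart_at \<A> p)"
    unfolding chart_at_def by blast+
qed

lemma smooth_transition:
  assumes "c \<in> \<A>" "d \<in> \<A>"
  shows "Ck_on k (snd d \<circ> chart_inv c) (snd c ` (fst c \<inter> fst d))"
  using assms smooth_structure by (auto simp: smooth_structure_def compatible_def smooth_on_def)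

text \<open>The differential of the coordinate change from \<open>c\<close> to \<open>d\<close> at the point \<open>p\<close>. Both
  \<open>push\<close> and \<open>coord_field\<close> are instances in which one of the two charts is the preferred
  chart of \<open>p\<close>, so the cocycle identity below turns every change of chart into algebra.\<close>

definition jac :: "('p, 'e) chart \<Rightarrow> ('p, 'e) chart \<Rightarrow> 'p \<Rightarrow> 'e \<Rightarrow> 'e" where
  "jac c d p = frechet_derivative (snd d \<circ> chart_inv c) (at (snd c p))"

lemma push_eq_jac: "push \<A> c p = jac (chart_at \<A> p) c p"
  by (rule ext) (simp add: push_def jac_def)

lemma coord_field_eq_jac: "coord_field \<A> c u p = jac c (chart_at \<A> p) p u"
  by (simp add: coord_field_def jac_def)

lemma transition_has_derivative:
  assumes "c \<in> \<A>" "d \<in> \<A>" "p \<in> fst c" "p \<in> fst d"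
  shows "(snd d \<circ> chart_inv c has_derivative jac c d p) (at (snd c p))"
  unfolding jac_def
  using Ck_on_SucD[OF smooth_transition[OF assms(1,2), of "Suc 0"] open_chart_image[OF assms(1)
      chartD(1)[OF assms(2)]]] assms
  by blast

lemma linear_jac:
  assumes "c \<in> \<A>" "d \<in> \<A>" "p \<in> fst c" "p \<in> fst d"
  shows "linear (jac c d p)"
  using transition_has_derivative[OF assms] by (rule has_derivative_linear)

lemma chain_transition:
  assumes "c \<in> \<A>" "d \<in> \<A>" "p \<in> fst c" "p \<in> fst d"
    and f: "(f \<circ> chart_inv d has_derivative f') (at (snd d p))"
  shows "(f \<circ> chart_inv c has_derivative f' \<circ> jac c d p) (at (snd c p))"
proof -
  have "((f \<circ> chart_inv d) \<circ> (snd d \<circ> chart_inv c) has_derivative f' \<circ> jac c d p) (at (snd c p))"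
    by (rule diff_chain_at[OF transition_has_derivative[OF assms(1-4)]])
      (use f assms in \<open>simp add: chart_inv_left\<close>)
  then show ?thesis
  proof (rule has_derivative_transform_within_open)
    show "open (snd c ` (fst c \<inter> fst d))" using assms open_chart_image chartD by blast
    show "snd c p \<in> snd c ` (fst c \<inter> fst d)" using assms by blast
  qed (use assms in \<open>auto simp: chart_inv_left\<close>)
qed

lemma jac_cocycle:
  assumes "c \<in> \<A>" "d \<in> \<A>" "e \<in> \<A>" "p \<in> fst c" "p \<in> fst d" "p \<in> fst e"
  shows "jac d e p (jac c d p u) = jac c e p u"
proof -
  have "(snd e \<circ> chart_inv c has_derivative jac d e p \<circ> jac c d p) (at (snd c p))"
    using assms by (intro chain_transition transition_has_derivative)
  from has_derivative_unique[OF this transition_has_derivative] assms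
  show ?thesis by (metis comp_apply)
qed

lemma jac_self:
  assumes "c \<in> \<A>" "p \<in> fst c"
  shows "jac c c p u = u"
proof -
  have "(snd c \<circ> chart_inv c has_derivative id) (at (snd c p))"
    by (rule has_derivative_transform_within_open[OF has_derivative_id chartD(2)[OF assms(1)]])
      (use assms in \<open>auto simp: chart_inv_left\<close>)
  from has_derivative_unique[OF this transition_has_derivative] assms show ?thesis by (metis id_apply)
qed

lemma coord_field_push: 
  assumes "c \<in> \<A>" "p \<in> fst c"
  shows "coord_field \<A> c (push \<A> c p v) p = v"
  using assms chart_at by (simp add: push_eq_jac coord_field_eq_jac jac_cocycle jac_self)

lemma linear_coord_field:
  assumes "c \<in> \<A>" "p \<in> fst c"
  shows "linear (\<lambda>u. coord_field \<A> c u p)"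
  using linear_jac[OF assms(1) chart_at(1) assms(2) chart_at(2)] by (simp add: coord_field_eq_jac)

lemma coord_field_nonzero:
  assumes "c \<in> \<A>" "p \<in> fst c" "u \<noteq> 0"
  shows "coord_field \<A> c u p \<noteq> 0"
proof
  assume "coord_field \<A> c u p = 0"
  then have "jac (chart_at \<A> p) c p (jac c (chart_at \<A> p) p u) = 0"
    using linear_jac[OF chart_at(1) assms(1) chart_at(2) assms(2)]
        by (simp add: coord_field_eq_jac linear_0)
  then show False using assms chart_at by (simp add: jac_cocycle jac_self)
qed

text \<open>A field with constant components in \<open>c\<close> has, in another chart \<open>d\<close>, the components
  \<open>D(d \<circ> c\<inverse>)u\<close> evaluated at \<open>c \<circ> d\<inverse>\<close>; this is smooth by closure under composition. The
  axioms for metrics and connections can be applied only to fields known to be smooth, so this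
  lemma gives access to both.\<close>

lemma smooth_coord_field:
  assumes c: "c \<in> \<A>"
  shows "smooth_field \<A> (fst c) (coord_field \<A> c u)"
  unfolding smooth_field_def smooth_on_def
proof (intro ballI allI)
  fix d k assume d: "d \<in> \<A>"
  let ?S = "snd d ` (fst d \<inter> fst c)" and ?T = "snd c ` (fst c \<inter> fst d)"
  have S: "open ?S" and T: "open ?T" using c d open_chart_image chartD(1) by blast+
  have "Ck_on k ((\<lambda>x. frechet_derivative (snd d \<circ> chart_inv c) (at x) u) \<circ> (snd c \<circ> chart_inv d)) ?S"
  proof (rule Ck_on_compose[OF S T])
    show "Ck_on k (\<lambda>x. frechet_derivative (snd d \<circ> chart_inv c) (at x) u) ?T"
      using smooth_transition[OF c d, of "Suc k"] by simp
    show "Ck_on k (snd c \<circ> chart_inv d) ?S" by (rule smooth_transition[OF d c])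
    show "(snd c \<circ> chart_inv d) ` ?S \<subseteq> ?T" using d by (auto simp: chart_inv_left)
  qed
  then show "Ck_on k (field_rep \<A> d (coord_field \<A> c u)) ?S"
  proof (rule Ck_on_cong[OF S])
    fix x assume "x \<in> ?S"
    then obtain p where p: "x = snd d p" "p \<in> fst d" "p \<in> fst c" by blast
    have "field_rep \<A> d (coord_field \<A> c u) x = jac c d p u"
      using p c d chart_at by (simp add: field_rep_def chart_inv_left push_eq_jac coord_field_eq_jac
          jac_cocycle)
    then show "((\<lambda>x. frechet_derivative (snd d \<circ> chart_inv c) (at x) u) \<circ> (snd c \<circ> chart_inv d)) x =
         field_rep \<A> d (coord_field \<A> c u) x"
      using p d by (simp add: jac_def chart_inv_left)
  qed
qed

lemma smooth_fun_Ck: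
  assumes "smooth_fun \<A> U f" "d \<in> \<A>"
  shows "Ck_on k (f \<circ> chart_inv d) (snd d ` (fst d \<inter> U))"
  using assms by (auto simp: smooth_fun_def smooth_map_def Ck_map_def euclid_atlas_def)

text \<open>\<open>dir_deriv\<close> is computed in the preferred chart of each point, which may jump from point to
  point. Here it is brought into one chart \<open>c\<close>.\<close>

lemma dir_deriv_coord_field:
  assumes c: "c \<in> \<A>" and p: "p \<in> fst c" "p \<in> U" and U: "open U" and f: "smooth_fun \<A> U f"
  shows "(f \<circ> chart_inv c has_derivative (\<lambda>w. dir_deriv \<A> p (coord_field \<A> c w p) f)) (at (snd c p))"
proof -
  let ?d = "chart_at \<A> p"
  have "(f \<circ> chart_inv ?d has_derivative frechet_derivative (f \<circ> chart_inv ?d) (at (snd ?d p)))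
      (at (snd ?d p))"
    using Ck_on_SucD[OF smooth_fun_Ck[OF f chart_at(1), of "Suc 0"] open_chart_image[OF chart_at(1)
        U]] p chart_at(2)
    by blast
  from chain_transition[OF c chart_at(1) p(1) chart_at(2) this]
  show ?thesis by (simp add: dir_deriv_def coord_field_eq_jac comp_def)
qed

text \<open>\<open>velocity\<close> also refers to the preferred chart of each curve point. Expressing it by the
  derivative in a fixed chart makes it comparable along the curve.\<close>

lemma velocity_eq:
  assumes ab: "a < b" and t: "t \<in> {a..b}" and \<gamma>: "continuous_on {a..b} \<gamma>"
    and c: "c \<in> \<A>" "\<gamma> t \<in> fst c"
    and w: "(snd c \<circ> \<gamma> has_vector_derivative w) (at t within {a..b})"
  shows "velocity \<A> {a..b} \<gamma> t = coord_field \<A> c w (\<gamma> t)"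
proof -
  let ?d = "chart_at \<A> (\<gamma> t)"
  have "(snd c \<circ> \<gamma> has_derivative (\<lambda>x. x *\<^sub>R w)) (at t within {a..b})"
    using w by (simp add: has_vector_derivative_def)
  moreover have "(snd ?d \<circ> chart_inv c has_derivative jac c ?d (\<gamma> t))
      (at ((snd c \<circ> \<gamma>) t) within (snd c \<circ> \<gamma>) ` {a..b})"
    using transition_has_derivative[OF c(1) chart_at(1) c(2) chart_at(2)] has_derivative_at_withinI by auto
  ultimately have 1: "((snd ?d \<circ> chart_inv c) \<circ> (snd c \<circ> \<gamma>) has_derivative jac c ?d (\<gamma> t) \<circ>
      (\<lambda>x. x *\<^sub>R w)) (at t within {a..b})"
    by (intro diff_chain_within) (auto intro: has_derivative_subset)
  have ev: "\<forall>\<^sub>F s in at t within {a..b}. \<gamma> s \<in> fst c"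
    using \<gamma> t c chartD(1)[OF c(1)] by (auto simp: continuous_on_def intro: topological_tendstoD)
  have "(snd ?d \<circ> \<gamma> has_derivative jac c ?d (\<gamma> t) \<circ> (\<lambda>x. x *\<^sub>R w)) (at t within {a..b})"
    by (rule has_derivative_transform_eventually[OF 1])
      (use ev c t in \<open>auto simp: chart_inv_left elim: eventually_mono\<close>)
  moreover have "jac c ?d (\<gamma> t) \<circ> (\<lambda>x. x *\<^sub>R w) = (\<lambda>x. x *\<^sub>R coord_field \<A> c w (\<gamma> t))"
    using linear_jac[OF c(1) chart_at(1) c(2) chart_at(2)] by (auto simp: coord_field_eq_jac linear_scale)
  ultimately have "(snd ?d \<circ> \<gamma> has_vector_derivative coord_field \<A> c w (\<gamma> t)) (at t within {a..b})"
    by (simp add: has_vector_derivative_def)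
  then show ?thesis
    unfolding velocity_def using vector_derivative_within_closed_interval[OF ab t] by auto
qed

end

section \<open>The metric in coordinates\<close>

locale riem_mfd =
  fixes \<A> :: "('p::t2_space, 'e::euclidean_space) chart set"
    and g :: "'p \<Rightarrow> 'e \<Rightarrow> 'e \<Rightarrow> real"
  assumes riemannian: "riemannian_manifold \<A> g"
begin

sublocale smooth_mfd \<A>
  using riemannian by unfold_locales (simp add: riemannian_manifold_def)

lemma metric:
  shows "bilinear (g p)" "g p u v = g p v u" "v \<noteq> 0 \<Longrightarrow> 0 < g p v v"
  using riemannian unfolding riemannian_manifold_def by blast+

lemma metric_nonneg: "0 \<le> g p v v"
  using metric(3)[of v p] bilinear_lzero[OF metric(1)] by (cases "v = 0") (auto simp: less_imp_le)

lemma metric_scale: "g p (k *\<^sub>R v) (k *\<^sub>R v) = k\<^sup>2 * g p v v"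
  by (simp add: bilinear_lmul[OF metric(1)] bilinear_rmul[OF metric(1)] power2_eq_square)

text \<open>The Gram matrix of the metric in the chart \<open>c\<close>, as a bilinear form on the model space.\<close>

definition gram :: "('p, 'e) chart \<Rightarrow> 'e \<Rightarrow> 'e \<Rightarrow> 'e \<Rightarrow> real" where
  "gram c x u v = g (chart_inv c x) (coord_field \<A> c u (chart_inv c x)) (coord_field \<A> c v (chart_inv c x))"

lemma gram_at: 
  "c \<in> \<A> \<Longrightarrow> p \<in> fst c \<Longrightarrow> gram c (snd c p) u v = g p (coord_field \<A> c u p) (coord_field \<A> c v p)"
  by (simp add: gram_def chart_inv_left)

lemma gram_sym: "gram c x u v = gram c x v u"
  by (simp add: gram_def metric(2)[of _ "coord_field \<A> c u _"])

lemma bilinear_gram: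
  assumes "c \<in> \<A>" "x \<in> snd c ` fst c"
  shows "bilinear (gram c x)"
proof -
  have l: "linear (\<lambda>u. coord_field \<A> c u (chart_inv c x))"
    using linear_coord_field assms chart_inv_right by blast
  show ?thesis
    unfolding bilinear_def gram_def
    using linear_compose[OF l, of "\<lambda>u. g (chart_inv c x) u _"] linear_compose[OF l, of "g (chart_inv c
        x) _"]
      metric(1)[of "chart_inv c x"]
    by (auto simp: bilinear_def comp_def)
qed

lemma gram_expand:
  assumes "c \<in> \<A>" "x \<in> snd c ` fst c"
  shows "gram c x u v = (\<Sum>i\<in>Basis. \<Sum>j\<in>Basis. (u \<bullet> i) * (v \<bullet> j) * gram c x i j)"
proof -
  have l: "linear (\<lambda>u. gram c x u v)" "\<And>u. linear (gram c x u)" for v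
    using bilinear_gram[OF assms] by (auto simp: bilinear_def)
  have "gram c x u v = (\<Sum>i\<in>Basis. (u \<bullet> i) *\<^sub>R gram c x i v)"
    by (rule linear_sum_Basis[OF l(1)])
  also have "\<dots> = (\<Sum>i\<in>Basis. (u \<bullet> i) *\<^sub>R (\<Sum>j\<in>Basis. (v \<bullet> j) *\<^sub>R gram c x i j))"
    by (intro sum.cong refl arg_cong2[where f="(*\<^sub>R)"] linear_sum_Basis[OF l(2)])
  finally show ?thesis by (simp add: sum_distrib_left mult.assoc)
qed

lemma smooth_metric_coord:
  assumes "c \<in> \<A>"
  shows "smooth_fun \<A> (fst c) (\<lambda>p. g p (coord_field \<A> c u p) (coord_field \<A> c v p))"
  using riemannian smooth_coord_field[OF assms] chartD(1)[OF assms]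
  unfolding riemannian_manifold_def by blast

lemma Ck_gram:
  assumes "c \<in> \<A>"
  shows "Ck_on k (\<lambda>x. gram c x u v) (snd c ` fst c)"
  using smooth_fun_Ck[OF smooth_metric_coord[OF assms] assms, of k u v]
  by (simp add: gram_def comp_def)

lemma gram_has_derivative:
  assumes "c \<in> \<A>" "x \<in> snd c ` fst c"
  shows "((\<lambda>x. gram c x u v) has_derivative frechet_derivative (\<lambda>x. gram c x u v) (at x)) (at x)"
  using Ck_on_SucD[OF Ck_gram[OF assms(1), of "Suc 0"] chartD(2)[OF assms(1)] assms(2)] .

lemma gram_pos:
  assumes "c \<in> \<A>" "x \<in> snd c ` fst c" "v \<noteq> 0"
  shows "0 < gram c x v v"
  using assms coord_field_nonzero chart_inv_right by (simp add: gram_def metric(3))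

lemma gram_scale:
  assumes "c \<in> \<A>" "x \<in> snd c ` fst c"
  shows "gram c x (k *\<^sub>R v) (k *\<^sub>R v) = k\<^sup>2 * gram c x v v"
  using bilinear_gram[OF assms]
  by (simp add: bilinear_lmul bilinear_rmul power2_eq_square)

text \<open>Over a compact set of coordinates the metric is uniformly equivalent to the Euclidean norm:
  the Gram form is continuous and positive on the product of this set with the unit sphere, so it
  attains a positive minimum and a maximum there, and homogeneity does the rest.\<close>

lemma gram_bounds:
  assumes c: "c \<in> \<A>" and N: "compact N" "N \<subseteq> snd c ` fst c"
  obtains \<alpha> \<beta> where "0 < \<alpha>" "0 < \<beta>"
    "\<And>x v. x \<in> N \<Longrightarrow> \<alpha> * norm v \<le> sqrt (gram c x v v)"
    "\<And>x v. x \<in> N \<Longrightarrow> sqrt (gram c x v v) \<le> \<beta> * norm v"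
proof (cases "N = {}")
  case True
  then show ?thesis using that[of 1 1] by simp
next
  case False
  let ?S = "N \<times> sphere (0::'e) 1" and ?f = "\<lambda>z. gram c (fst z) (snd z) (snd z)"
  have S: "compact ?S" "?S \<noteq> {}"
    using N(1) False by (auto intro: compact_Times)
  have "continuous_on ?S (\<lambda>z. \<Sum>i\<in>Basis. \<Sum>j\<in>Basis. (snd z \<bullet> i) * (snd z \<bullet> j) * gram c (fst z) i j)"
  proof (intro continuous_intros)
    fix i j :: 'e
    have "continuous_on (snd c ` fst c) (\<lambda>x. gram c x i j)"
      using Ck_gram[OF c, of 0] by simp
    then show "continuous_on ?S (\<lambda>z. gram c (fst z) i j)"
      by (rule continuous_on_compose2) (use N in \<open>auto intro: continuous_on_fst continuous_on_id\<close>)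
  qed
  moreover have "(\<Sum>i\<in>Basis. \<Sum>j\<in>Basis. (snd z \<bullet> i) * (snd z \<bullet> j) * gram c (fst z) i j) = ?f z"
    if "z \<in> ?S" for z
    using gram_expand[OF c, of "fst z" "snd z" "snd z"] that N by auto
  ultimately have cont: "continuous_on ?S ?f"
    by (simp cong: continuous_on_cong)
  obtain z where z: "z \<in> ?S" "\<And>y. y \<in> ?S \<Longrightarrow> ?f z \<le> ?f y"
    using continuous_attains_inf[OF S cont] by blast
  obtain z' where z': "z' \<in> ?S" "\<And>y. y \<in> ?S \<Longrightarrow> ?f y \<le> ?f z'"
    using continuous_attains_sup[OF S cont] by blast
  have pos: "0 < ?f y" if "y \<in> ?S" for y
    using that N(2) by (intro gram_pos[OF c]) auto
  have eq: "sqrt (gram c x v v) = norm v * sqrt (?f (x, v /\<^sub>R norm v))" if "x \<in> N" "v \<noteq> 0" for x v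
    using gram_scale[OF c, of x "norm v" "v /\<^sub>R norm v"] that N(2) by (auto simp: real_sqrt_mult)
  have mem: "(x, v /\<^sub>R norm v) \<in> ?S" if "x \<in> N" "v \<noteq> 0" for x v
    using that by simp
  have zero: "gram c x 0 0 = 0" if "x \<in> N" for x
    using bilinear_lzero[OF bilinear_gram[OF c]] N(2) that by blast
  show ?thesis
  proof (rule that[of "sqrt (?f z)" "sqrt (?f z')"])
    show "0 < sqrt (?f z)" "0 < sqrt (?f z')" using pos z(1) z'(1) by simp_all
    fix x v assume x: "x \<in> N"
    show "sqrt (?f z) * norm v \<le> sqrt (gram c x v v)"
      using z(2)[OF mem[OF x, of v]] eq[OF x, of v] zero[OF x]
      by (cases "v = 0") (auto simp: mult.commute intro!: mult_left_mono)
    show "sqrt (gram c x v v) \<le> sqrt (?f z') * norm v"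
      using z'(2)[OF mem[OF x, of v]] eq[OF x, of v] zero[OF x]
      by (cases "v = 0") (auto simp: mult.commute intro!: mult_left_mono)
  qed
qed

text \<open>The product rule for \<open>G(u)(w, w)\<close>, where \<open>G\<close> is symmetric and bilinear. Expansion in a basis
  avoids having to differentiate \<open>G\<close> as a map into bilinear forms; \<open>D\<close> is its derivative with
  both arguments frozen at \<open>w t\<close>.\<close>

lemma gram_along_curve:
  fixes u w :: "real \<Rightarrow> 'e"
  assumes c: "c \<in> \<A>" and t: "t \<in> I" and x: "u t \<in> snd c ` fst c"
    and u: "(u has_vector_derivative w t) (at t within I)"
    and w: "(w has_vector_derivative w') (at t within I)"
    and D: "((\<lambda>x. gram c x (w t) (w t)) has_derivative D) (at (u t))"
  shows "((\<lambda>s. gram c (u s) (w s) (w s)) has_real_derivative D (w t) + 2 * gram c (u t) w' (w t))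
      (at t within I)"
proof -
  let ?G = "\<lambda>i j x. gram c x i j"
  let ?D = "\<lambda>i j. frechet_derivative (?G i j) (at (u t))"
  let ?v = "w t"
  have uD: "(u has_derivative (\<lambda>h. h *\<^sub>R ?v)) (at t within I)"
    using u by (simp add: has_vector_derivative_def)
  have G: "((\<lambda>s. ?G i j (u s)) has_real_derivative ?D i j ?v) (at t within I)" for i j
  proof -
    have "(?G i j \<circ> u has_derivative ?D i j \<circ> (\<lambda>h. h *\<^sub>R ?v)) (at t within I)"
      by (rule diff_chain_within[OF uD]) (use gram_has_derivative[OF c x] in \<open>auto intro:
          has_derivative_at_withinI\<close>)
    moreover have "?D i j \<circ> (\<lambda>h. h *\<^sub>R ?v) = (*) (?D i j ?v)"
      using has_derivative_linear[OF gram_has_derivative[OF c x, of i j]] by (auto simp: linear_scale)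
    ultimately show ?thesis by (simp add: has_field_derivative_def comp_def)
  qed
  have wi: "((\<lambda>s. w s \<bullet> i) has_real_derivative w' \<bullet> i) (at t within I)" for i
    using bounded_linear.has_vector_derivative[OF bounded_linear_inner_left w]
    by (simp add: has_real_derivative_iff_has_vector_derivative)
  have "((\<lambda>s. \<Sum>i\<in>Basis. \<Sum>j\<in>Basis. (w s \<bullet> i) * (w s \<bullet> j) * ?G i j (u s)) has_real_derivative
      (\<Sum>i\<in>Basis. \<Sum>j\<in>Basis. (w' \<bullet> i) * (?v \<bullet> j) * ?G i j (u t) + (?v \<bullet> i) * (w' \<bullet> j) * ?G i j (u t)
          + (?v \<bullet> i) * (?v \<bullet> j) * ?D i j ?v)) (at t within I)"
    by (rule DERIV_sum DERIV_cong[OF DERIV_mult[OF DERIV_mult[OF wi wi] G]])+ (simp add: algebra_simps)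
  moreover have "(\<Sum>i\<in>Basis. \<Sum>j\<in>Basis. (w' \<bullet> i) * (?v \<bullet> j) * ?G i j (u t) + (?v \<bullet> i) * (w' \<bullet> j) * ?G i
      j (u t)
          + (?v \<bullet> i) * (?v \<bullet> j) * ?D i j ?v) = gram c (u t) w' ?v + gram c (u t) ?v w' + D ?v"
  proof -
    \<comment> \<open>The terms in which only the matrix entries are differentiated add up to \<open>D\<close>, by uniqueness of
        the derivative.\<close>
    have "((\<lambda>x. \<Sum>i\<in>Basis. \<Sum>j\<in>Basis. (?v \<bullet> i) * (?v \<bullet> j) * ?G i j x) has_derivative
        (\<lambda>h. \<Sum>i\<in>Basis. \<Sum>j\<in>Basis. (?v \<bullet> i) * (?v \<bullet> j) * ?D i j h)) (at (u t))"
      by (intro has_derivative_sum has_derivative_mult_right gram_has_derivative[OF c x])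
    then have "((\<lambda>x. gram c x ?v ?v) has_derivative
        (\<lambda>h. \<Sum>i\<in>Basis. \<Sum>j\<in>Basis. (?v \<bullet> i) * (?v \<bullet> j) * ?D i j h)) (at (u t))"
      by (rule has_derivative_transform_within_open[OF _ chartD(2)[OF c] x])
          (rule gram_expand[OF c, symmetric])
    from has_derivative_unique[OF D this] show ?thesis
      by (simp add: sum.distrib gram_expand[OF c x, of w' ?v] gram_expand[OF c x, of ?v w'])
  qed
  ultimately have deriv: "((\<lambda>s. \<Sum>i\<in>Basis. \<Sum>j\<in>Basis. (w s \<bullet> i) * (w s \<bullet> j) * ?G i j (u s))
      has_real_derivative
      D ?v + 2 * gram c (u t) w' ?v) (at t within I)"
    by (simp add: gram_sym[of c "u t" ?v w'] algebra_simps)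
  have "\<forall>\<^sub>F s in at t within I. u s \<in> snd c ` fst c"
    using has_derivative_continuous[OF uD] chartD(2)[OF c] x
    by (auto simp: continuous_within intro: topological_tendstoD)
  then have ev: "\<forall>\<^sub>F s in at t within I. (\<Sum>i\<in>Basis. \<Sum>j\<in>Basis. (w s \<bullet> i) * (w s \<bullet> j) * ?G i j (u s))
      = gram c (u s) (w s) (w s)"
    by eventually_elim (simp add: gram_expand[OF c, of _ "w _" "w _", symmetric])
  show ?thesis
    unfolding has_field_derivative_def
    by (rule has_derivative_transform_eventually[OF deriv[unfolded has_field_derivative_def] ev])
        (use t gram_expand[OF c x, of "w t" "w t"] in auto)
qed

section \<open>Curves of constant speed\<close>

text \<open>Minimizing segments are of this kind, and so are the curves obtained from them by restriction
  and reversal; a join of two of them has a step function as its speed. Their lengths are therefore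
  computed without integration theory.\<close>

definition constant_speed :: "real \<Rightarrow> real \<Rightarrow> (real \<Rightarrow> 'p) \<Rightarrow> real \<Rightarrow> bool" where
  "constant_speed a b \<gamma> s \<longleftrightarrow> a < b \<and> 0 \<le> s \<and> C1_curve \<A> a b \<gamma> \<and>
     (\<forall>t\<in>{a..b}. g (\<gamma> t) (velocity \<A> {a..b} \<gamma> t) (velocity \<A> {a..b} \<gamma> t) = s\<^sup>2)"

lemma C1_curveE:
  assumes "C1_curve \<A> a b \<gamma>" "c \<in> \<A>"
  obtains w where "continuous_on ({a..b} \<inter> \<gamma> -` fst c) w"
    "\<And>t. t \<in> {a..b} \<Longrightarrow> \<gamma> t \<in> fst c \<Longrightarrow> (snd c \<circ> \<gamma> has_vector_derivative w t) (at t within {a..b})"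
  using assms unfolding C1_curve_def by (metis IntI vimageI)

lemma C1_curve_continuous: "C1_curve \<A> a b \<gamma> \<Longrightarrow> continuous_on {a..b} \<gamma>"
  by (simp add: C1_curve_def)

lemma C1_curve_cong:
  assumes "C1_curve \<A> a b \<gamma>" "\<And>t. t \<in> {a..b} \<Longrightarrow> \<gamma> t = \<gamma>' t"
  shows "C1_curve \<A> a b \<gamma>'"
  unfolding C1_curve_def
proof (intro conjI ballI)
  show "continuous_on {a..b} \<gamma>'"
    by (rule continuous_on_eq[OF C1_curve_continuous[OF assms(1)] assms(2)])
  fix c assume "c \<in> \<A>"
  from C1_curveE[OF assms(1) this] obtain w where w: "continuous_on ({a..b} \<inter> \<gamma> -` fst c) w"
    "\<And>t. t \<in> {a..b} \<Longrightarrow> \<gamma> t \<in> fst c \<Longrightarrow> (snd c \<circ> \<gamma> has_vector_derivative w t) (at t within {a..b})"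
    by blast
  have "{a..b} \<inter> \<gamma>' -` fst c = {a..b} \<inter> \<gamma> -` fst c"
    using assms(2) by auto
  moreover have "(snd c \<circ> \<gamma>' has_vector_derivative w t) (at t within {a..b})"
    if "t \<in> {a..b} \<inter> \<gamma> -` fst c" for t
    by (rule has_vector_derivative_transform[OF _ _ w(2)]) (use that assms(2) in auto)
  ultimately show "\<exists>w. continuous_on ({a..b} \<inter> \<gamma>' -` fst c) w \<and>
        (\<forall>t\<in>{a..b} \<inter> \<gamma>' -` fst c. (snd c \<circ> \<gamma>' has_vector_derivative w t) (at t within {a..b}))"
    using w(1) by auto
qed

text \<open>Holds for arbitrary curves because the integral of a function that is not integrable is \<open>0\<close>.
  Hence the lengths competing in the infimum are bounded below, and each of them bounds the
  distance from above.\<close>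

lemma curve_length_nonneg: "0 \<le> curve_length \<A> g a b \<gamma>"
  unfolding curve_length_def using metric_nonneg 
  by (cases "(\<lambda>t. sqrt (g (\<gamma> t) (velocity \<A> {a..b} \<gamma> t) (velocity \<A> {a..b} \<gamma> t))) integrable_on {a..b}")
     (auto intro!: integral_nonneg simp: not_integrable_integral)

lemma riem_dist_le:
  assumes "a < b" "piecewise_C1_curve \<A> a b \<gamma>"
  shows "riem_dist \<A> g (\<gamma> a) (\<gamma> b) \<le> curve_length \<A> g a b \<gamma>"
  unfolding riem_dist_def
  using assms by (intro cInf_lower) (auto intro!: bdd_belowI[of _ 0] curve_length_nonneg)

lemma piecewise_C1_curveI: "a < b \<Longrightarrow> C1_curve \<A> a b \<gamma> \<Longrightarrow> piecewise_C1_curve \<A> a b \<gamma>"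
  unfolding piecewise_C1_curve_def
  by (intro exI[of _ 1] exI[of _ "\<lambda>i. if i = 0 then a else b"]) auto

lemma constant_speed_length:
  assumes "constant_speed a b \<gamma> s"
  shows "curve_length \<A> g a b \<gamma> = s * (b - a)"
proof -
  have "curve_length \<A> g a b \<gamma> = integral {a..b} (\<lambda>t. s)"
    unfolding curve_length_def using assms by (intro integral_cong) (simp add: constant_speed_def)
  then show ?thesis using assms by (simp add: constant_speed_def)
qed

lemma dist_le_constant_speed:
  assumes "constant_speed a b \<gamma> s"
  shows "riem_dist \<A> g (\<gamma> a) (\<gamma> b) \<le> s * (b - a)"
  using riem_dist_le[of a b \<gamma>] piecewise_C1_curveI[of a b \<gamma>] constant_speed_length[OF assms] assms
  by (simp add: constant_speed_def)

text \<open>Covers restriction to a subinterval, translation of the parameter and reversal, according to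
  the choice of \<open>k\<close> and \<open>d\<close>.\<close>

lemma constant_speed_affine:
  assumes cs: "constant_speed a b \<gamma> s" and ab: "a' < b'"
    and img: "\<And>t. t \<in> {a'..b'} \<Longrightarrow> k * t + d \<in> {a..b}"
  shows "constant_speed a' b' (\<lambda>t. \<gamma> (k * t + d)) (\<bar>k\<bar> * s)"
proof -
  let ?\<gamma> = "\<lambda>t. \<gamma> (k * t + d)"
  have C1: "C1_curve \<A> a b \<gamma>" using cs by (simp add: constant_speed_def)
  have cont: "continuous_on {a'..b'} ?\<gamma>"
    by (rule continuous_on_compose2[OF C1_curve_continuous[OF C1]])
        (use img in \<open>auto intro!: continuous_intros\<close>)
  \<comment> \<open>Chart derivatives scale by \<open>k\<close>, in every chart; this gives both the class \<open>C\<^sup>1\<close> and the speed.\<close>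
  have deriv: "(snd c \<circ> ?\<gamma> has_vector_derivative k *\<^sub>R w) (at t within {a'..b'})"
    if "t \<in> {a'..b'}" "(snd c \<circ> \<gamma> has_vector_derivative w) (at (k * t + d) within {a..b})"
        for c :: "('p, 'e) chart" and w t
  proof -
    have 1: "((\<lambda>t. k * t + d) has_vector_derivative k) (at t within {a'..b'})"
      by (auto intro!: derivative_eq_intros)
    have 2: "(snd c \<circ> \<gamma> has_vector_derivative w) (at (k * t + d) within (\<lambda>t. k * t + d) ` {a'..b'})"
      by (rule has_vector_derivative_within_subset[OF that(2)]) (use img in auto)
    show ?thesis
      using vector_diff_chain_within[OF 1 2] by (simp add: comp_def)
  qed
  have C1': "C1_curve \<A> a' b' ?\<gamma>"
    unfolding C1_curve_def
  proof (intro conjI ballI cont)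
    fix c assume c: "c \<in> \<A>"
    obtain w where w: "continuous_on ({a..b} \<inter> \<gamma> -` fst c) w"
      "\<And>t. t \<in> {a..b} \<Longrightarrow> \<gamma> t \<in> fst c \<Longrightarrow> (snd c \<circ> \<gamma> has_vector_derivative w t) (at t within {a..b})"
      using C1_curveE[OF C1 c] by blast
    have "continuous_on ({a'..b'} \<inter> ?\<gamma> -` fst c) (\<lambda>t. w (k * t + d))"
      by (rule continuous_on_compose2[OF w(1)]) (use img in \<open>auto intro!: continuous_intros\<close>)
    then show "\<exists>w. continuous_on ({a'..b'} \<inter> ?\<gamma> -` fst c) w \<and>
          (\<forall>t\<in>{a'..b'} \<inter> ?\<gamma> -` fst c. (snd c \<circ> ?\<gamma> has_vector_derivative w t) (at t within {a'..b'}))"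
      using img w(2) by (intro exI[of _ "\<lambda>t. k *\<^sub>R w (k * t + d)"]) (auto intro!: continuous_intros deriv)
  qed
  moreover have "g (?\<gamma> t) (velocity \<A> {a'..b'} ?\<gamma> t) (velocity \<A> {a'..b'} ?\<gamma> t) = (\<bar>k\<bar> * s)\<^sup>2"
    if t: "t \<in> {a'..b'}" for t
  proof -
    let ?c = "chart_at \<A> (?\<gamma> t)"
    obtain w where w: "(snd ?c \<circ> \<gamma> has_vector_derivative w) (at (k * t + d) within {a..b})"
      using C1_curveE[OF C1 chart_at(1)] img[OF t] chart_at(2) by metis
    have "velocity \<A> {a..b} \<gamma> (k * t + d) = coord_field \<A> ?c w (?\<gamma> t)"
      using cs by (intro velocity_eq[OF _ img[OF t] C1_curve_continuous[OF C1] chart_at w])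
          (simp add: constant_speed_def)
    moreover have "velocity \<A> {a'..b'} ?\<gamma> t = coord_field \<A> ?c (k *\<^sub>R w) (?\<gamma> t)"
      by (rule velocity_eq[OF ab t cont chart_at deriv[OF t w]])
    ultimately have "velocity \<A> {a'..b'} ?\<gamma> t = k *\<^sub>R velocity \<A> {a..b} \<gamma> (k * t + d)"
      using linear_scale[OF linear_coord_field[OF chart_at]] by simp
    then show ?thesis
      using cs img[OF t] by (simp add: metric_scale constant_speed_def power_mult_distrib)
  qed
  ultimately show ?thesis using cs ab by (simp add: constant_speed_def)
qed

text \<open>\<open>velocity\<close> takes the derivative relative to the whole parameter interval. At an interior point
  of a piece it is the velocity of that piece, whatever happens at the break points.\<close>

lemma velocity_interior:
  assumes C1: "C1_curve \<A> a' b' \<gamma>'" and cont: "continuous_on {a..b} \<gamma>"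
    and eq: "\<And>t. t \<in> {a'..b'} \<Longrightarrow> \<gamma> t = \<gamma>' t" and le: "a \<le> a'" "b' \<le> b" and t: "a' < t" "t < b'"
  shows "velocity \<A> {a..b} \<gamma> t = velocity \<A> {a'..b'} \<gamma>' t"
proof -
  let ?c = "chart_at \<A> (\<gamma>' t)"
  have tt: "\<gamma> t = \<gamma>' t" using eq t by simp
  obtain w where w: "(snd ?c \<circ> \<gamma>' has_vector_derivative w) (at t within {a'..b'})"
    using C1_curveE[OF C1 chart_at(1)] t chart_at(2) by (metis atLeastAtMost_iff less_imp_le)
  have "(snd ?c \<circ> \<gamma> has_vector_derivative w) (at t)"
    by (rule has_vector_derivative_transform_within_open[of "snd ?c \<circ> \<gamma>'" _ _ "{a'<..<b'}"])
       (use w t eq at_within_Icc_at[OF t] in auto)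
  then have "velocity \<A> {a..b} \<gamma> t = coord_field \<A> ?c w (\<gamma> t)"
    using t le chart_at[of "\<gamma>' t"] 
    by (intro velocity_eq cont) (auto simp: tt intro: has_vector_derivative_at_within)
  moreover have "velocity \<A> {a'..b'} \<gamma>' t = coord_field \<A> ?c w (\<gamma>' t)"
    using t by (intro velocity_eq C1_curve_continuous[OF C1] w chart_at) auto
  ultimately show ?thesis by (simp add: tt)
qed

text \<open>The source of the triangle inequality: the joined curve on \<open>[0, 2]\<close> is piecewise \<open>C\<^sup>1\<close>, and its
  speed is \<open>s1\<close> and then \<open>s2\<close> except at \<open>0\<close>, \<open>1\<close> and \<open>2\<close>.\<close>

lemma dist_le_joined_curves:
  assumes 1: "constant_speed 0 1 \<gamma>1 s1" and 2: "constant_speed 0 1 \<gamma>2 s2" and join: "\<gamma>1 1 = \<gamma>2 0"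
  shows "riem_dist \<A> g (\<gamma>1 0) (\<gamma>2 1) \<le> s1 + s2"
proof -
  define \<gamma> where "\<gamma> t = (if t \<le> 1 then \<gamma>1 t else \<gamma>2 (t - 1))" for t
  have 3: "constant_speed 1 2 (\<lambda>t. \<gamma>2 (t - 1)) s2"
    using constant_speed_affine[OF 2, of 1 2 1 "-1"] by simp
  have eq1: "\<gamma> t = \<gamma>1 t" if "t \<in> {0..1}" for t using that by (simp add: \<gamma>_def)
  have eq2: "\<gamma> t = \<gamma>2 (t - 1)" if "t \<in> {1..2}" for t using that join by (cases "t = 1") (auto simp: \<gamma>_def)
  have C1: "C1_curve \<A> 0 1 \<gamma>1" "C1_curve \<A> 1 2 (\<lambda>t. \<gamma>2 (t - 1))"
    using 1 3 by (auto simp: constant_speed_def)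
  have C: "C1_curve \<A> 0 1 \<gamma>" "C1_curve \<A> 1 2 \<gamma>"
    using C1_curve_cong[OF C1(1)] C1_curve_cong[OF C1(2)] eq1 eq2 by metis+
  have "{0..2} = {0..1} \<union> {1..(2::real)}" by auto
  then have cont: "continuous_on {0..2} \<gamma>"
    using C[THEN C1_curve_continuous] by (simp add: continuous_on_closed_Un)
  have pw: "piecewise_C1_curve \<A> 0 2 \<gamma>"
    unfolding piecewise_C1_curve_def
    by (intro exI[of _ 2] exI[of _ real]) (use C in \<open>auto simp: less_2_cases_iff\<close>)
  let ?f = "\<lambda>t. sqrt (g (\<gamma> t) (velocity \<A> {0..2} \<gamma> t) (velocity \<A> {0..2} \<gamma> t))"
  have f1: "?f t = s1" if "t \<in> {0..1} - {0, 1}" for t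
    using velocity_interior[OF C1(1) cont eq1, of t] eq1[of t] that 1 by (auto simp: constant_speed_def)
  have f2: "?f t = s2" if "t \<in> {1..2} - {1, 2}" for t
    using velocity_interior[OF C1(2) cont eq2, of t] eq2[of t] that 3 by (auto simp: constant_speed_def)
  have "(?f has_integral s1) {0..1}"
    by (rule has_integral_spike_finite[of "{0, 1}" _ _ "\<lambda>_. s1"]) (use f1
        has_integral_const_real[of s1 0 1] in auto)
  moreover have "(?f has_integral s2) {1..2}"
    by (rule has_integral_spike_finite[of "{1, 2}" _ _ "\<lambda>_. s2"]) (use f2
        has_integral_const_real[of s2 1 2] in auto)
  ultimately have "(?f has_integral s1 + s2) {0..2}"
    by (intro has_integral_combine[of 0 1 2]) auto
  then have "curve_length \<A> g 0 2 \<gamma> = s1 + s2"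
    by (simp add: curve_length_def integral_unique)
  then show ?thesis using riem_dist_le[OF _ pw] by (simp add: \<gamma>_def)
qed

end

context riem_mfd begin

section \<open>Riemannian distance against coordinate distance\<close>

lemma coord_speed:
  assumes cs: "constant_speed a b \<gamma> s" and t: "t \<in> {a..b}" and c: "c \<in> \<A>" "\<gamma> t \<in> fst c"
    and w: "(snd c \<circ> \<gamma> has_vector_derivative w) (at t within {a..b})"
  shows "sqrt (gram c (snd c (\<gamma> t)) w w) = s"
proof -
  have "velocity \<A> {a..b} \<gamma> t = coord_field \<A> c w (\<gamma> t)"
    using cs by (intro velocity_eq[OF _ t _ c w]) (auto simp: constant_speed_def C1_curve_continuous)
  then have "gram c (snd c (\<gamma> t)) w w = s\<^sup>2"
    using cs t unfolding gram_at[OF c] constant_speed_def by metis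
  then show ?thesis using cs by (simp add: constant_speed_def)
qed

text \<open>One radius serves all of \<open>K\<close>: the closed coordinate balls around points of \<open>K\<close> together form
  a compact subset of the chart image, over which the metric has uniform bounds.\<close>

lemma chart_ball_bounds:
  assumes c: "c \<in> \<A>" and K: "compact K" "K \<subseteq> fst c"
  obtains r \<alpha> \<beta> where "0 < r" "0 < \<alpha>" "0 < \<beta>"
    "\<And>X. X \<in> K \<Longrightarrow> cball (snd c X) r \<subseteq> snd c ` fst c"
    "\<And>X x v. X \<in> K \<Longrightarrow> x \<in> cball (snd c X) r \<Longrightarrow> \<alpha> * norm v \<le> sqrt (gram c x v v)"
    "\<And>X x v. X \<in> K \<Longrightarrow> x \<in> cball (snd c X) r \<Longrightarrow> sqrt (gram c x v v) \<le> \<beta> * norm v"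
proof -
  have cK: "compact (snd c ` K)"
    using K continuous_on_subset[OF continuous_chart[OF c]] by (intro compact_continuous_image) auto
  obtain r where r: "0 < r" "(\<Union>x\<in>snd c ` K. cball x r) \<subseteq> snd c ` fst c"
    by (rule compact_subset_open_imp_cball_epsilon_subset[OF cK chartD(2)[OF c] image_mono[OF K(2)]])
  obtain \<alpha> \<beta> where "0 < \<alpha>" "0 < \<beta>"
    and bounds: "\<And>x v. x \<in> (\<Union>x\<in>snd c ` K. cball x r) \<Longrightarrow> \<alpha> * norm v \<le> sqrt (gram c x v v)"
    "\<And>x v. x \<in> (\<Union>x\<in>snd c ` K. cball x r) \<Longrightarrow> sqrt (gram c x v v) \<le> \<beta> * norm v"
    using gram_bounds[OF c compact_minkowski_sum_cball[OF cK] r(2)] by blast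
  show ?thesis
  proof (rule that[of r \<alpha> \<beta>])
    show "cball (snd c X) r \<subseteq> snd c ` fst c" if "X \<in> K" for X using r(2) that by blast
  qed (use r(1) \<open>0 < \<alpha>\<close> \<open>0 < \<beta>\<close> bounds in blast)+
qed

text \<open>The segment that is straight in the chart competes in the infimum, and its speed is at most
  \<open>\<beta>\<close> times the Euclidean length of the segment.\<close>

lemma riem_dist_le_straight:
  assumes c: "c \<in> \<A>" and XY: "X \<in> fst c" "Y \<in> fst c" "coord_dist c X Y \<le> r"
    and ball: "cball (snd c X) r \<subseteq> snd c ` fst c"
    and \<beta>: "\<And>x v. x \<in> cball (snd c X) r \<Longrightarrow> sqrt (gram c x v v) \<le> \<beta> * norm v"
  shows "riem_dist \<A> g X Y \<le> \<beta> * coord_dist c X Y"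
proof -
  define e where "e = snd c Y - snd c X"
  define u where "u t = snd c X + t *\<^sub>R e" for t :: real
  define \<gamma> where "\<gamma> t = chart_inv c (u t)" for t
  have e: "norm e = coord_dist c X Y" by (simp add: e_def coord_dist_def norm_minus_commute)
  have u: "u t \<in> cball (snd c X) r" if "t \<in> {0..1}" for t
  proof -
    have "\<bar>t\<bar> * norm e \<le> 1 * norm e" using that by (intro mult_right_mono) auto
    then show ?thesis using e XY(3) by (simp add: u_def dist_norm)
  qed
  have in_c: "\<gamma> t \<in> fst c" "snd c (\<gamma> t) = u t" if "t \<in> {0..1}" for t
    using u[OF that] ball chart_inv_right[OF c] by (auto simp: \<gamma>_def)
  have cont: "continuous_on {0..1} \<gamma>"
    unfolding \<gamma>_def 
    by (rule continuous_on_compose2[OF continuous_chart_inv[OF c]])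
      (use u ball in \<open>auto simp: u_def intro!: continuous_intros\<close>)
  have uD: "(u has_vector_derivative e) (at t within {0..1})" for t
    unfolding u_def by (auto intro!: derivative_eq_intros)
  have cD: "(snd c \<circ> \<gamma> has_vector_derivative e) (at t within {0..1})" if "t \<in> {0..1}" for t
    by (rule has_vector_derivative_transform[OF that _ uD]) (simp add: in_c)
  have C1: "C1_curve \<A> 0 1 \<gamma>"
    unfolding C1_curve_def
  proof (intro conjI cont ballI)
    fix d assume d: "d \<in> \<A>"
    let ?S = "snd c ` (fst c \<inter> fst d)"
    have S: "open ?S" using open_chart_image[OF c chartD(1)[OF d]] .
    let ?w = "\<lambda>t. frechet_derivative (snd d \<circ> chart_inv c) (at (u t)) e"
    have mem: "u t \<in> ?S" if "t \<in> {0..1} \<inter> \<gamma> -` fst d" for t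
      using that in_c[of t] by (metis IntE IntI image_eqI vimageE)
    have "continuous_on ?S (\<lambda>x. frechet_derivative (snd d \<circ> chart_inv c) (at x) e)"
      using smooth_transition[OF c d, of "Suc 0"] by simp
    then have "continuous_on ({0..1} \<inter> \<gamma> -` fst d) ?w"
      by (rule continuous_on_compose2) (use mem in \<open>auto simp: u_def intro!: continuous_intros\<close>)
    moreover have "(snd d \<circ> \<gamma> has_vector_derivative ?w t) (at t within {0..1})" if t: "t
        \<in> {0..1} \<inter> \<gamma> -` fst d" for t
    proof -
      have D: "(snd d \<circ> chart_inv c has_derivative frechet_derivative (snd d \<circ> chart_inv c)
          (at (u t))) (at (u t))"
        using Ck_on_SucD[OF smooth_transition[OF c d, of "Suc 0"] S mem[OF t]] .
      have "((snd d \<circ> chart_inv c) \<circ> u has_derivative frechet_derivative (snd d \<circ> chart_inv c)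
          (at (u t)) \<circ> (\<lambda>h. h *\<^sub>R e)) (at t within {0..1})"
        using uD[of t] D by (intro diff_chain_within) (auto simp: has_vector_derivative_def intro:
            has_derivative_at_withinI)
      moreover have "frechet_derivative (snd d \<circ> chart_inv c) (at (u t)) \<circ> (\<lambda>h. h *\<^sub>R e) = (\<lambda>h. h *\<^sub>R ?w t)"
        using has_derivative_linear[OF D] by (auto simp: linear_scale)
      moreover have "(snd d \<circ> chart_inv c) \<circ> u = snd d \<circ> \<gamma>" by (auto simp: \<gamma>_def)
      ultimately show ?thesis by (simp add: has_vector_derivative_def)
    qed
    ultimately show "\<exists>w. continuous_on ({0..1} \<inter> \<gamma> -` fst d) w \<and>
       (\<forall>t\<in>{0..1} \<inter> \<gamma> -` fst d. (snd d \<circ> \<gamma> has_vector_derivative w t) (at t within {0..1}))" by blast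
  qed
  let ?f = "\<lambda>t. sqrt (g (\<gamma> t) (velocity \<A> {0..1} \<gamma> t) (velocity \<A> {0..1} \<gamma> t))"
  have f: "?f t \<le> \<beta> * norm e" if t: "t \<in> {0..1}" for t
    using velocity_eq[OF _ t cont c in_c(1)[OF t] cD[OF t]] gram_at[OF c in_c(1)[OF t], of e e] \<beta>[OF
        u[OF t], of e] in_c(2)[OF t]
    by simp
  \<comment> \<open>A speed that is not integrable has integral \<open>0\<close>, so the bound must also be nonnegative.\<close>
  have "0 \<le> ?f 0" using metric_nonneg by simp
  also have "?f 0 \<le> \<beta> * norm e" by (rule f) simp
  finally have "0 \<le> \<beta> * norm e" .
  then have "curve_length \<A> g 0 1 \<gamma> \<le> \<beta> * norm e"
    unfolding curve_length_def
    using integral_le[of ?f "{0..1}" "\<lambda>_. \<beta> * norm e"] f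
    by (cases "?f integrable_on {0..1}") (auto simp: not_integrable_integral)
  moreover have "\<gamma> 0 = X" "\<gamma> 1 = Y"
    using XY c by (auto simp: \<gamma>_def u_def e_def chart_inv_left)
  ultimately show ?thesis
    using riem_dist_le[OF _ piecewise_C1_curveI[OF _ C1]] e by simp
qed

text \<open>As long as the curve stays in the ball, its coordinate speed is at most \<open>\<rho> = s / \<alpha> < r\<close>, so up to
  time \<open>1\<close> it stays in the compact ball of radius \<open>\<rho>\<close>. At a first time outside the open ball of
  radius \<open>r\<close> it would, by continuity, still be in that smaller ball. This gives a lower bound for
  the distance, and even shows that the end point lies in the chart.\<close>

lemma short_curve_stays_in_chart_ball:
  assumes c: "c \<in> \<A>" and cs: "constant_speed 0 1 \<gamma> s"
    and X: "\<gamma> 0 \<in> fst c" and ball: "cball (snd c (\<gamma> 0)) r \<subseteq> snd c ` fst c"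
    and \<alpha>: "0 < \<alpha>" "\<And>x v. x \<in> cball (snd c (\<gamma> 0)) r \<Longrightarrow> \<alpha> * norm v \<le> sqrt (gram c x v v)"
    and short: "s < \<alpha> * r"
  shows "\<gamma> 1 \<in> fst c" "\<alpha> * coord_dist c (\<gamma> 0) (\<gamma> 1) \<le> s"
proof -
  let ?x = "snd c (\<gamma> 0)" and ?\<rho> = "s / \<alpha>"
  have s: "0 \<le> s" and C1: "C1_curve \<A> 0 1 \<gamma>" using cs by (auto simp: constant_speed_def)
  note cont = C1_curve_continuous[OF C1]
  have \<rho>: "0 \<le> ?\<rho>" "?\<rho> < r" using s \<alpha>(1) short by (auto simp: field_simps)
  define G where "G = fst c \<inter> snd c -` ball ?x r"
  define F where "F = chart_inv c ` cball ?x ?\<rho>"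
  have G: "open G"
    unfolding G_def by (intro continuous_open_preimage continuous_chart c chartD(1) open_ball)
  have sub: "cball ?x ?\<rho> \<subseteq> snd c ` fst c" using ball \<rho>(2) by (auto simp: subset_iff)
  have F: "closed F"
    unfolding F_def
    by (intro compact_imp_closed compact_continuous_image continuous_on_subset[OF
        continuous_chart_inv[OF c] sub] compact_cball)
  have FG: "F \<subseteq> G" 
    using chart_inv_right[OF c] sub \<rho>(2) by (auto simp: F_def G_def)
  obtain w where w: "\<And>t. t \<in> {0..1} \<Longrightarrow> \<gamma> t \<in> fst c \<Longrightarrow> (snd c \<circ> \<gamma> has_vector_derivative w t)
      (at t within {0..1})"
    using C1_curveE[OF C1 c] by blast
  have bound: "norm (snd c (\<gamma> T) - ?x) \<le> ?\<rho>" if T: "T \<in> {0..1}" and inG: "\<And>t. t \<in> {0..T} \<Longrightarrow> \<gamma> t \<in> G" for T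
  proof -
    have "norm ((snd c \<circ> \<gamma>) T - (snd c \<circ> \<gamma>) 0) \<le> ?\<rho> * norm (T - 0)"
    proof (rule differentiable_bound[where S="{0..T}" and f'="\<lambda>t h. h *\<^sub>R w t"])
      fix t assume t: "t \<in> {0..T}"
      have t1: "t \<in> {0..1}" and tc: "\<gamma> t \<in> fst c" "snd c (\<gamma> t) \<in> cball ?x r"
        using t T inG[OF t] by (auto simp: G_def)
      have "(snd c \<circ> \<gamma> has_vector_derivative w t) (at t within {0..T})"
        using w[OF t1 tc(1)] by (rule has_vector_derivative_within_subset) (use T in auto)
      then show "(snd c \<circ> \<gamma> has_derivative (\<lambda>h. h *\<^sub>R w t)) (at t within {0..T})"
        by (simp add: has_vector_derivative_def)
      have "\<alpha> * norm (w t) \<le> s"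
        using \<alpha>(2)[OF tc(2), of "w t"] coord_speed[OF cs t1 c tc(1) w[OF t1 tc(1)]] by simp
      then have "norm (w t) \<le> ?\<rho>" using \<alpha>(1) by (simp add: field_simps)
      then have "\<bar>h\<bar> * norm (w t) \<le> \<bar>h\<bar> * ?\<rho>" for h :: real
        by (intro mult_left_mono) auto
      then show "onorm (\<lambda>h. h *\<^sub>R w t) \<le> ?\<rho>"
        by (intro onorm_le) (simp add: mult.commute)
    qed (use T in auto)
    also have "?\<rho> * norm (T - 0) \<le> ?\<rho> * 1" using T \<rho>(1) by (intro mult_left_mono) auto
    finally show ?thesis by simp
  qed
  have inG: "\<gamma> t \<in> G" if "t \<in> {0..1}" for t
  proof (rule ccontr)
    assume "\<gamma> t \<notin> G"
    \<comment> \<open>\<open>Inf B\<close> is the first time outside \<open>G\<close>; it belongs to \<open>B\<close> because \<open>G\<close> is open.\<close>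
    define B where "B = {0..1} \<inter> \<gamma> -` (- G)"
    have "closed B" unfolding B_def using G by (intro continuous_closed_preimage cont) auto
    moreover have "B \<noteq> {}" "bdd_below B" using that \<open>\<gamma> t \<notin> G\<close>
        by (auto simp: B_def intro!: bdd_belowI[of _ 0])
    ultimately have \<tau>B: "Inf B \<in> B" by (intro closed_contains_Inf)
    define \<tau> where "\<tau> = Inf B"
    have \<tau>: "\<tau> \<in> {0..1}" "\<gamma> \<tau> \<notin> G" using \<tau>B by (auto simp: B_def \<tau>_def)
    have before: "\<gamma> t \<in> G" if "t \<in> {0..<\<tau>}" for t
      using cInf_lower[OF _ \<open>bdd_below B\<close>, of t] that \<tau>(1) by (force simp: B_def \<tau>_def)
    have "0 < r" using \<rho> by linarith
    then have "\<gamma> 0 \<in> G" using X by (simp add: G_def)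
    then have pos: "0 < \<tau>" using \<tau> by (cases "\<tau> = 0") auto
    have "{0..<\<tau>} \<subseteq> {0..1} \<inter> \<gamma> -` F"
    proof
      fix t assume t: "t \<in> {0..<\<tau>}"
      then have "norm (snd c (\<gamma> t) - ?x) \<le> ?\<rho>" using \<tau>(1) by (intro bound before) auto
      then have "snd c (\<gamma> t) \<in> cball ?x ?\<rho>" by (simp add: dist_norm norm_minus_commute)
      moreover have "chart_inv c (snd c (\<gamma> t)) = \<gamma> t" using before[OF t] c
          by (simp add: G_def chart_inv_left)
      ultimately have "\<gamma> t \<in> F" unfolding F_def by (metis image_eqI)
      then show "t \<in> {0..1} \<inter> \<gamma> -` F" using t \<tau>(1) by auto
    qed
    then have "closure {0..<\<tau>} \<subseteq> {0..1} \<inter> \<gamma> -` F"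
      by (rule closure_minimal) (intro continuous_closed_preimage cont closed_atLeastAtMost F)
    moreover have "\<tau> \<in> closure {0..<\<tau>}" using pos by simp
    ultimately have "\<gamma> \<tau> \<in> F" by blast
    then show False using FG \<tau>(2) by blast
  qed
  show "\<gamma> 1 \<in> fst c" using inG[of 1] by (simp add: G_def)
  show "\<alpha> * coord_dist c (\<gamma> 0) (\<gamma> 1) \<le> s"
    using bound[of 1] inG \<alpha>(1) by (simp add: coord_dist_def field_simps norm_minus_commute)
qed

section \<open>Geodesics of a metric connection\<close>

text \<open>In a chart, the derivative of \<open>G(u)(u', u')\<close> is \<open>D G(u)(u', u')[u'] + 2 G(u)(u'', u')\<close>. Self-duality
  of the connection, applied to the field with constant components \<open>u'(t)\<close>, identifies the first
  term with \<open>2 G(u)(\<Gamma>(u', u'), u')\<close>, and the geodesic equation \<open>u'' = -\<Gamma>(u', u')\<close> makes the second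
  its negative. The local statements in varying charts combine because the speed itself does not
  depend on a chart.\<close>

lemma metric_geodesic_constant_speed:
  assumes compat: "dual_connection \<A> g nabg nabg" and geo: "geodesic \<A> nabg \<gamma>"
  shows "\<exists>s. constant_speed 0 1 \<gamma> s"
proof -
  have cont: "continuous_on {0..1} \<gamma>" using geo by (simp add: geodesic_def)
  have ex: "\<exists>w. \<forall>t\<in>{0..1} \<inter> \<gamma> -` fst c.
        (snd c \<circ> \<gamma> has_vector_derivative w t) (at t within {0..1}) \<and>
        (w has_vector_derivative - christoffel \<A> nabg c (\<gamma> t) (w t) (w t)) (at t within {0..1})" if "c
            \<in> \<A>" for c
    using geo that by (simp add: geodesic_def)
  have C1: "C1_curve \<A> 0 1 \<gamma>"
    unfolding C1_curve_def
  proof (intro conjI cont ballI)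
    fix c assume "c \<in> \<A>"
    then obtain w where w: "\<And>t. t \<in> {0..1} \<inter> \<gamma> -` fst c \<Longrightarrow> (snd c \<circ> \<gamma> has_vector_derivative w t)
        (at t within {0..1})"
      "\<And>t. t \<in> {0..1} \<inter> \<gamma> -` fst c \<Longrightarrow> (w
          has_vector_derivative - christoffel \<A> nabg c (\<gamma> t) (w t) (w t)) (at t within {0..1})"
      using ex by blast
    have "continuous_on ({0..1} \<inter> \<gamma> -` fst c) w"
      unfolding continuous_on_eq_continuous_within
      using has_vector_derivative_continuous[OF w(2)] continuous_within_subset by blast
    then show "\<exists>w. continuous_on ({0..1} \<inter> \<gamma> -` fst c) w \<and>
       (\<forall>t\<in>{0..1} \<inter> \<gamma> -` fst c. (snd c \<circ> \<gamma> has_vector_derivative w t) (at t within {0..1}))"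
      using w(1) by blast
  qed
  let ?E = "\<lambda>t. g (\<gamma> t) (velocity \<A> {0..1} \<gamma> t) (velocity \<A> {0..1} \<gamma> t)"
  have "(?E has_field_derivative 0) (at t within {0..1})" if t: "t \<in> {0..1}" for t
  proof -
    let ?p = "\<gamma> t"
    let ?c = "chart_at \<A> ?p"
    note c = chart_at(1)[of ?p] and p = chart_at(2)[of ?p]
    obtain w where w: "\<And>t. t \<in> {0..1} \<inter> \<gamma> -` fst ?c \<Longrightarrow> (snd ?c \<circ> \<gamma> has_vector_derivative w t)
        (at t within {0..1})"
      "\<And>t. t \<in> {0..1} \<inter> \<gamma> -` fst ?c \<Longrightarrow> (w
          has_vector_derivative - christoffel \<A> nabg ?c (\<gamma> t) (w t) (w t)) (at t within {0..1})"
      using ex[OF c] by blast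
    let ?u = "snd ?c \<circ> \<gamma>" and ?v = "w t"
    \<comment> \<open>The velocity at time \<open>t\<close>, extended to a field with constant components in the chart.\<close>
    let ?F = "coord_field \<A> ?c ?v"
    let ?\<Gamma> = "christoffel \<A> nabg ?c ?p ?v ?v"
    let ?D = "\<lambda>h. dir_deriv \<A> ?p (coord_field \<A> ?c h ?p) (\<lambda>q. g q (?F q) (?F q))"
    have D: "((\<lambda>x. gram ?c x ?v ?v) has_derivative ?D) (at (?u t))"
      using dir_deriv_coord_field[OF c p p chartD(1)[OF c] smooth_metric_coord[OF c]]
      by (simp add: gram_def comp_def)
    have "?D ?v = g ?p (nabg ?p (?F ?p) ?F) (?F ?p) + g ?p (?F ?p) (nabg ?p (?F ?p) ?F)"
      using compat smooth_coord_field[OF c] chartD(1)[OF c] p unfolding dual_connection_def by blast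
    also have "nabg ?p (?F ?p) ?F = coord_field \<A> ?c ?\<Gamma> ?p"
      by (simp add: christoffel_def coord_field_push[OF c p])
    finally have Dv: "?D ?v = 2 * gram ?c (?u t) ?\<Gamma> ?v"
      by (simp add: gram_at[OF c p] metric(2)[of ?p "?F ?p"])
    have "((\<lambda>s. gram ?c (?u s) (w s) (w s)) has_real_derivative ?D ?v + 2 * gram ?c (?u t) (- ?\<Gamma>) ?v)
        (at t within {0..1})"
      by (rule gram_along_curve[OF c t _ w(1) w(2) D]) (use t p in auto)
    moreover have "gram ?c (?u t) (- ?\<Gamma>) ?v = - gram ?c (?u t) ?\<Gamma> ?v"
      using bilinear_lneg[OF bilinear_gram[OF c]] p by auto
    ultimately have "((\<lambda>s. gram ?c (?u s) (w s) (w s)) has_real_derivative 0) (at t within {0..1})"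
      using Dv by simp
    moreover have E: "gram ?c (?u s) (w s) (w s) = ?E s" if "s \<in> {0..1}" "\<gamma> s \<in> fst ?c" for s
      using velocity_eq[OF _ that(1) cont c that(2) w(1)] that gram_at[OF c that(2)] by simp
    moreover have "\<forall>\<^sub>F s in at t within {0..1}. \<gamma> s \<in> fst ?c"
      using cont t p chartD(1)[OF c] by (auto simp: continuous_on_def intro: topological_tendstoD)
    then have "\<forall>\<^sub>F s in at t within {0..1}. gram ?c (?u s) (w s) (w s) = ?E s"
      using eventually_at_topological E by (auto simp: eventually_at_topological)
    ultimately show ?thesis
      using has_derivative_transform_eventually[of "\<lambda>s. gram ?c (?u s) (w s) (w s)" _ t "{0..1}" ?E] t p
      by (simp add: has_field_derivative_def)
  qed
  then obtain k where k: "\<And>t. t \<in> {0..1} \<Longrightarrow> ?E t = k"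
    using has_field_derivative_zero_constant[of "{0..1}" ?E] by auto
  have "0 \<le> k" using k[of 0] metric_nonneg by (metis atLeastAtMost_iff order_refl zero_le_one)
  then show ?thesis
    using k C1 by (intro exI[of _ "sqrt k"]) (simp add: constant_speed_def)
qed

end

section \<open>Distance and midpoints in a strongly convex set\<close>

locale convex_region = riem_mfd \<A> g
  for \<A> :: "('p::t2_space, 'e::euclidean_space) chart set" and g +
  fixes nabg :: "'p \<Rightarrow> 'e \<Rightarrow> ('p \<Rightarrow> 'e) \<Rightarrow> 'e" and V :: "'p set"
  assumes compat: "dual_connection \<A> g nabg nabg"
    and convex: "strongly_convex \<A> g nabg V"
begin

abbreviation dist_g :: "'p \<Rightarrow> 'p \<Rightarrow> real" where
  "dist_g \<equiv> riem_dist \<A> g"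

abbreviation mid :: "'p \<Rightarrow> 'p \<Rightarrow> 'p" where
  "mid X Y \<equiv> min_midpoint_map \<A> g nabg (X, Y)"

text \<open>Constant speed on \<open>[0, 1]\<close> and length equal to the distance force the speed to be the distance.\<close>

lemma segment:
  assumes "X \<in> V" "Y \<in> V"
  obtains \<gamma> where "constant_speed 0 1 \<gamma> (dist_g X Y)" "\<gamma> 0 = X" "\<gamma> 1 = Y" "\<gamma> (1/2) = mid X Y" "mid X Y \<in> V"
proof -
  let ?\<Phi> = "minimizing_segment \<A> g nabg X Y"
  have uniq: "unique_curve ?\<Phi>" and inV: "\<And>\<gamma>. ?\<Phi> \<gamma> \<Longrightarrow> \<gamma> ` {0..1} \<subseteq> V"
    using convex assms by (auto simp: strongly_convex_def)
  obtain \<gamma> where \<gamma>: "?\<Phi> \<gamma>" and un: "\<And>\<gamma>'. ?\<Phi> \<gamma>' \<Longrightarrow> \<forall>t\<in>{0..1}. \<gamma>' t = \<gamma> t"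
    using uniq by (auto simp: unique_curve_def)
  obtain s where s: "constant_speed 0 1 \<gamma> s"
    using metric_geodesic_constant_speed[OF compat] \<gamma>
        by (auto simp: minimizing_segment_def geodesic_segment_def)
  have "s = dist_g X Y"
    using constant_speed_length[OF s] \<gamma> by (simp add: minimizing_segment_def)
  moreover have "curve_midpoint ?\<Phi> = \<gamma> (1/2)"
    unfolding curve_midpoint_def
  proof (rule the_equality)
    show "\<exists>\<gamma>'. ?\<Phi> \<gamma>' \<and> \<gamma> (1/2) = \<gamma>' (1/2)" using \<gamma> by blast
    show "m = \<gamma> (1/2)" if "\<exists>\<gamma>'. ?\<Phi> \<gamma>' \<and> m = \<gamma>' (1/2)" for m
      using that un by force
  qed
  moreover have "\<gamma> (1/2) \<in> V" using inV[OF \<gamma>] by auto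
  ultimately show ?thesis
    using that[of \<gamma>] s \<gamma> by (simp add: min_midpoint_map_def minimizing_segment_def geodesic_segment_def)
qed

lemma mid_in: "X \<in> V \<Longrightarrow> Y \<in> V \<Longrightarrow> mid X Y \<in> V"
  using segment by metis

lemma dist_nonneg: "X \<in> V \<Longrightarrow> Y \<in> V \<Longrightarrow> 0 \<le> dist_g X Y"
  using segment[of X Y] by (metis constant_speed_def)

lemma dist_triangle:
  assumes "X \<in> V" "Y \<in> V" "Z \<in> V"
  shows "dist_g X Z \<le> dist_g X Y + dist_g Y Z"
proof -
  obtain \<gamma> where "constant_speed 0 1 \<gamma> (dist_g X Y)" "\<gamma> 0 = X" "\<gamma> 1 = Y" using segment assms by metis
  moreover obtain \<gamma>' where "constant_speed 0 1 \<gamma>' (dist_g Y Z)" "\<gamma>' 0 = Y" "\<gamma>' 1 = Z"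
      using segment assms by metis
  ultimately show ?thesis using dist_le_joined_curves by metis
qed

lemma dist_sym:
  assumes "X \<in> V" "Y \<in> V"
  shows "dist_g X Y = dist_g Y X"
proof -
  have "dist_g Y X \<le> dist_g X Y" if XY: "X \<in> V" "Y \<in> V" for X Y
  proof -
    obtain \<gamma> where \<gamma>: "constant_speed 0 1 \<gamma> (dist_g X Y)" "\<gamma> 0 = X" "\<gamma> 1 = Y" using segment XY by metis
    show ?thesis
      using dist_le_constant_speed[OF constant_speed_affine[OF \<gamma>(1), of 0 1 "-1" 1]] \<gamma>(2,3) by simp
  qed
  then show ?thesis using assms by (intro antisym) auto
qed

text \<open>Each half of the minimizing segment has length \<open>d(X, Y) / 2\<close>, which bounds both distances from
  above; if one of them were smaller, the triangle inequality would make \<open>d(X, Y)\<close> smaller than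
  itself.\<close>

lemma dist_mid:
  assumes X: "X \<in> V" and Y: "Y \<in> V"
  shows "dist_g X (mid X Y) = dist_g X Y / 2" "dist_g Y (mid X Y) = dist_g X Y / 2"
proof -
  obtain \<gamma> where \<gamma>: "constant_speed 0 1 \<gamma> (dist_g X Y)" "\<gamma> 0 = X" "\<gamma> 1 = Y" "\<gamma> (1/2)
      = mid X Y" "mid X Y \<in> V"
    using segment[OF X Y] by metis
  have "dist_g X (mid X Y) \<le> dist_g X Y / 2"
    using dist_le_constant_speed[OF constant_speed_affine[OF \<gamma>(1), of 0 "1/2" 1 0]] \<gamma>(2,4) by simp
  moreover have "dist_g (mid X Y) Y \<le> dist_g X Y / 2"
    using dist_le_constant_speed[OF constant_speed_affine[OF \<gamma>(1), of "1/2" 1 1 0]] \<gamma>(3,4) by simp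
  moreover have "dist_g X Y \<le> dist_g X (mid X Y) + dist_g (mid X Y) Y"
    by (rule dist_triangle[OF X \<gamma>(5) Y])
  ultimately show "dist_g X (mid X Y) = dist_g X Y / 2" "dist_g Y (mid X Y) = dist_g X Y / 2"
    using dist_sym[OF Y \<gamma>(5)] by linarith+
qed

text \<open>A minimizing segment of speed \<open>0\<close> cannot leave a chart ball, and its coordinates do not change.\<close>

lemma dist_zeroD:
  assumes "X \<in> V" "Y \<in> V" "dist_g X Y = 0"
  shows "X = Y"
proof -
  let ?c = "chart_at \<A> X"
  note c = chart_at(1)[of X] and X = chart_at(2)[of X]
  obtain r \<alpha> \<beta> where r: "0 < r" "0 < \<alpha>" "cball (snd ?c X) r \<subseteq> snd ?c ` fst ?c"
    and \<alpha>: "\<And>x v. x \<in> cball (snd ?c X) r \<Longrightarrow> \<alpha> * norm v \<le> sqrt (gram ?c x v v)"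
    using chart_ball_bounds[OF c, of "{X}"] X by (metis compact_sing empty_subsetI insert_subset insertI1)
  obtain \<gamma> where \<gamma>: "constant_speed 0 1 \<gamma> 0" "\<gamma> 0 = X" "\<gamma> 1 = Y" using segment assms by metis
  have "Y \<in> fst ?c" "\<alpha> * coord_dist ?c X Y \<le> 0"
    using short_curve_stays_in_chart_ball[OF c \<gamma>(1), unfolded \<gamma>(2,3), OF X r(3,2) \<alpha>] r by auto
  then have "snd ?c X = snd ?c Y" using r(2) by (simp add: coord_dist_def mult_le_0_iff)
  then show ?thesis using chart_inv_left[OF c X] chart_inv_left[OF c \<open>Y \<in> fst ?c\<close>] by metis
qed

text \<open>Nearby points are compared by the straight segment and by the exit estimate. For distant
  points it suffices that the coordinate distance is bounded on \<open>K\<close>, that the Riemannian distance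
  is bounded below by the exit estimate, and that it is bounded above, by way of a finite net in
  \<open>K\<close>.\<close>

lemma dist_comparable:
  assumes c: "c \<in> \<A>" and K: "compact K" "K \<subseteq> fst c" "K \<subseteq> V"
  obtains a b where "0 < a" "0 < b"
    "\<And>X Y. X \<in> K \<Longrightarrow> Y \<in> K \<Longrightarrow> a * coord_dist c X Y \<le> dist_g X Y"
    "\<And>X Y. X \<in> K \<Longrightarrow> Y \<in> K \<Longrightarrow> dist_g X Y \<le> b * coord_dist c X Y"
proof -
  obtain r \<alpha> \<beta> where pos: "0 < r" "0 < \<alpha>" "0 < \<beta>"
    and ball: "\<And>X. X \<in> K \<Longrightarrow> cball (snd c X) r \<subseteq> snd c ` fst c"
    and \<alpha>: "\<And>X x v. X \<in> K \<Longrightarrow> x \<in> cball (snd c X) r \<Longrightarrow> \<alpha> * norm v \<le> sqrt (gram c x v v)"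
    and \<beta>: "\<And>X x v. X \<in> K \<Longrightarrow> x \<in> cball (snd c X) r \<Longrightarrow> sqrt (gram c x v v) \<le> \<beta> * norm v"
    using chart_ball_bounds[OF c K(1,2)] by blast
  have cK: "compact (snd c ` K)"
    using K continuous_on_subset[OF continuous_chart[OF c]] by (intro compact_continuous_image) auto
  have near: "dist_g X Y \<le> \<beta> * coord_dist c X Y" if "X \<in> K" "Y \<in> K" "coord_dist c X Y \<le> r" for X Y
    using riem_dist_le_straight[OF c _ _ that(3) ball[OF that(1)] \<beta>[OF that(1)]] that K(2) by blast
  \<comment> \<open>A finite net, every point of which is within distance \<open>\<beta> r\<close> of the points that it covers.
      The sum \<open>m\<close> of all mutual distances in the net is a convenient bound for each of them.\<close>
  obtain F where F: "F \<subseteq> K" "finite F" "snd c ` K \<subseteq> (\<Union>X\<in>F. ball (snd c X) r)"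
    by (rule compactE_image[OF cK, of K "\<lambda>X. ball (snd c X) r"]) (use pos(1) in auto)
  define m where "m = (\<Sum>(X, Y)\<in>F \<times> F. dist_g X Y)"
  have m: "dist_g X Y \<le> m" if "X \<in> F" "Y \<in> F" for X Y
    using member_le_sum[of "(X, Y)" "F \<times> F" "\<lambda>(X, Y). dist_g X Y"] that F K(3) dist_nonneg
    by (auto simp: m_def subset_iff)
  have m0: "0 \<le> m" unfolding m_def using F K(3) dist_nonneg by (intro sum_nonneg) (auto simp: subset_iff)
  have center: "\<exists>Z\<in>F. dist_g X Z \<le> \<beta> * r" if X: "X \<in> K" for X
  proof -
    obtain Z where Z: "Z \<in> F" "dist (snd c Z) (snd c X) < r" using F(3) X by auto
    then have d: "coord_dist c X Z \<le> r" by (simp add: coord_dist_def dist_norm norm_minus_commute)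
    have "dist_g X Z \<le> \<beta> * coord_dist c X Z" using near[OF X _ d] Z F(1) by blast
    also have "\<dots> \<le> \<beta> * r" using d pos(3) by simp
    finally show ?thesis using Z(1) by blast
  qed
  define b where "b = 2 * \<beta> + m / r"
  have upper: "dist_g X Y \<le> b * coord_dist c X Y" if X: "X \<in> K" and Y: "Y \<in> K" for X Y
  proof (cases "coord_dist c X Y \<le> r")
    case True
    have "\<beta> * coord_dist c X Y \<le> b * coord_dist c X Y"
      using pos m0 by (intro mult_right_mono) (auto simp: b_def coord_dist_def)
    then show ?thesis using near[OF X Y True] by linarith
  next
    case False
    obtain X' Y' where X': "X' \<in> F" "dist_g X X' \<le> \<beta> * r" and Y': "Y' \<in> F" "dist_g Y Y' \<le> \<beta> * r"
      using center X Y by meson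
    have V: "X \<in> V" "Y \<in> V" "X' \<in> V" "Y' \<in> V" using X Y X' Y' F(1) K(3) by auto
    have "dist_g X Y \<le> dist_g X X' + dist_g X' Y" using dist_triangle V by blast
    also have "dist_g X' Y \<le> dist_g X' Y' + dist_g Y' Y" using dist_triangle V by blast
    also have "dist_g Y' Y = dist_g Y Y'" using dist_sym V by blast
    finally have "dist_g X Y \<le> 2 * (\<beta> * r) + m" using X' Y' m[OF X'(1) Y'(1)] by linarith
    also have "\<dots> = b * r" using pos(1) by (simp add: b_def field_simps)
    also have "\<dots> \<le> b * coord_dist c X Y" using False pos m0 by (intro mult_left_mono) (auto simp: b_def)
    finally show ?thesis .
  qed
  obtain \<Delta> where \<Delta>: "0 < \<Delta>" "\<And>X. X \<in> K \<Longrightarrow> norm (snd c X) \<le> \<Delta>"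
    using compact_imp_bounded[OF cK] by (auto simp: bounded_pos)
  \<comment> \<open>The coordinate distance on \<open>K\<close> is at most \<open>2 \<Delta>\<close>; the second value is what pairs at
      Riemannian distance at least \<open>\<alpha> r\<close> require.\<close>
  define a where "a = min \<alpha> (\<alpha> * r / (2 * \<Delta>))"
  have lower: "a * coord_dist c X Y \<le> dist_g X Y" if X: "X \<in> K" and Y: "Y \<in> K" for X Y
  proof (cases "dist_g X Y < \<alpha> * r")
    case True
    have "X \<in> V" "Y \<in> V" "X \<in> fst c" using X Y K by auto
    then obtain \<gamma> where \<gamma>: "constant_speed 0 1 \<gamma> (dist_g X Y)" "\<gamma> 0 = X" "\<gamma> 1 = Y" using segment by metis
    have "\<alpha> * coord_dist c X Y \<le> dist_g X Y"
      using short_curve_stays_in_chart_ball(2)[OF c \<gamma>(1), unfolded \<gamma>(2,3), OF \<open>X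
          \<in> fst c\<close> ball[OF X] pos(2) \<alpha>[OF X] True]
      by blast
    moreover have "a * coord_dist c X Y \<le> \<alpha> * coord_dist c X Y"
      by (intro mult_right_mono) (auto simp: a_def coord_dist_def)
    ultimately show ?thesis by linarith
  next
    case False
    have "coord_dist c X Y \<le> 2 * \<Delta>"
      using norm_triangle_ineq4[of "snd c X" "snd c Y"] \<Delta>(2)[OF X] \<Delta>(2)[OF Y] by (simp add: coord_dist_def)
    then have "a * coord_dist c X Y \<le> \<alpha> * r / (2 * \<Delta>) * (2 * \<Delta>)"
      using pos \<Delta>(1) by (intro mult_mono) (auto simp: a_def coord_dist_def)
    then show ?thesis using False \<Delta>(1) by simp
  qed
  show ?thesis
  proof (rule that[of a b])
    show "0 < a" using pos \<Delta>(1) by (simp add: a_def)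
    show "0 < b" using pos m0 by (simp add: b_def add_pos_nonneg)
  qed (use lower upper in blast)+
qed

end

section \<open>Invariance along the iteration\<close>

lemma mean_iter_invariant:
  assumes "\<And>n. mean_iter A M z n \<in> S"
    and "\<And>z. z \<in> S \<Longrightarrow> N (A z, M z) = N z"
  shows "N (mean_iter A M z n) = N z"
proof (induction n)
  case 0 then show ?case by (simp add: mean_iter_def)
next
  case (Suc n)
  have "mean_iter A M z (Suc n) = (A (mean_iter A M z n), M (mean_iter A M z n))"
    by (simp add: mean_iter_def mean_step_def)
  then show ?case using assms(2)[OF assms(1), of n] Suc.IH by metis
qed

lemma gauss_comp_eq:
  fixes l :: "'p::t2_space"
  assumes "gauss_limit A M z l"
  shows "gauss_comp A M z = l"
  unfolding gauss_comp_def
  using assms by (intro the_equality) (auto simp: gauss_limit_def intro: LIMSEQ_unique)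

theorem theorem3p3:
  fixes \<A> :: "('p::{t2_space,second_countable_topology}, 'e::euclidean_space) chart set"
    and g :: "'p \<Rightarrow> 'e \<Rightarrow> 'e \<Rightarrow> real"
    and nab nab' nabg :: "'p \<Rightarrow> 'e \<Rightarrow> ('p \<Rightarrow> 'e) \<Rightarrow> 'e"
    and A M Mg :: "'p \<times> 'p \<Rightarrow> 'p"
    and b :: 'p
    and \<V> \<K> \<U> S\<^sub>A S\<^sub>M :: "'p set"
    and \<W> \<D> :: "('p \<times> 'p) set"
    and c :: "('p, 'e) chart"
    and \<epsilon> C :: real
  assumes "riemannian_manifold \<A> g"
    and "affine_connection \<A> nab"
    and "affine_connection \<A> nab'"
    and "dual_connection \<A> g nab nab'"
    and "levi_civita \<A> g nabg"
    and "normal_neighborhood \<A> nabg b \<V>"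
    and "strongly_convex \<A> g nabg \<V>"
    and "S\<^sub>A \<in> {UNIV, \<V>}" and "S\<^sub>M \<in> {UNIV, \<V>}"
    and "A = midpoint_map \<A> nab S\<^sub>A"
    and "M = midpoint_map \<A> nab' S\<^sub>M"
    and "Mg = min_midpoint_map \<A> g nabg"
    and "open \<W>" and "(b, b) \<in> \<W>" and "\<W> \<subseteq> \<V> \<times> \<V>"
    and "midpoint_uniquely_defined \<A> nab S\<^sub>A \<W>"
    and "midpoint_uniquely_defined \<A> nab' S\<^sub>M \<W>"
    and "Ck_map 2 (prod_atlas \<A> \<A>) \<A> \<W> A"
    and "Ck_map 2 (prod_atlas \<A> \<A>) \<A> \<W> M"
    and "\<forall>(X, Y)\<in>\<W>. A (X, Y) \<in> \<V> \<and> M (X, Y) \<in> \<V>"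
    and "\<forall>(X, Y)\<in>\<W>. Mg (A (X, Y), M (X, Y)) = Mg (X, Y)"
    and "c \<in> \<A>" and "b \<in> fst c"
    and "\<K> \<subseteq> \<V>"
    and "convergence_data c b \<W> A M \<K> \<U> \<D> \<epsilon> C"
  shows "\<exists>Cg>0. \<forall>P\<^sub>0 Q\<^sub>0 P Q \<delta>.
    (P\<^sub>0, Q\<^sub>0) \<in> \<D> \<and>
    (\<forall>n. (P n, Q n) = mean_iter A M (P\<^sub>0, Q\<^sub>0) n \<and> \<delta> n = riem_dist \<A> g (P n) (Q n)) \<longrightarrow>
      (\<exists>l. gauss_limit A M (P\<^sub>0, Q\<^sub>0) l) \<and>
      gauss_comp A M (P\<^sub>0, Q\<^sub>0) = Mg (P\<^sub>0, Q\<^sub>0) \<and>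
      (\<forall>n. \<delta> (Suc n) \<le> Cg * (\<delta> n)\<^sup>2 \<and>
           riem_dist \<A> g (P n) (Mg (P\<^sub>0, Q\<^sub>0)) = \<delta> n / 2 \<and>
           riem_dist \<A> g (Q n) (Mg (P\<^sub>0, Q\<^sub>0)) = \<delta> n / 2)"
proof -
  note c = \<open>c \<in> \<A>\<close> and Mg = \<open>Mg = min_midpoint_map \<A> g nabg\<close>
    and data = \<open>convergence_data c b \<W> A M \<K> \<U> \<D> \<epsilon> C\<close>
  interpret convex_region \<A> g nabg \<V>
    using assms(1,5,7) by unfold_locales (auto simp: levi_civita_def)
  have K: "compact \<K>" "\<K> \<subseteq> fst c" "\<K> \<times> \<K> \<subseteq> \<W>" "\<D> \<subseteq> \<K> \<times> \<K>" and C: "0 < C"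
    using data unfolding convergence_data_def by simp_all
  obtain L where L_data: "\<forall>z\<in>\<D>. L z \<in> \<K> \<and> gauss_limit A M z (L z) \<and>
      (\<forall>n P Q P' Q'. mean_iter A M z n = (P, Q) \<and> mean_iter A M z (Suc n) = (P', Q') \<longrightarrow>
         (P, Q) \<in> \<D> \<and>
         coord_dist c P' Q' \<le> C * (coord_dist c P Q)\<^sup>2 \<and>
         C * (coord_dist c P Q)\<^sup>2 \<le> 1/2 * coord_dist c P Q \<and>
         coord_dist c P (L z) \<le> 2 * coord_dist c P Q \<and>
         coord_dist c Q (L z) \<le> 3 * coord_dist c P Q)"
    using data unfolding convergence_data_def by (elim conjE exE) (rule that)
  have L: "\<And>z. z \<in> \<D> \<Longrightarrow> L z \<in> \<K> \<and> gauss_limit A M z (L z)"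
    and step: "\<And>z n P Q P' Q'. z \<in> \<D> \<Longrightarrow> mean_iter A M z n = (P, Q) \<Longrightarrow> mean_iter A M z (Suc n) = (P', Q') \<Longrightarrow>
       (P, Q) \<in> \<D> \<and> coord_dist c P' Q' \<le> C * (coord_dist c P Q)\<^sup>2"
    by (auto dest!: bspec[OF L_data])
  obtain \<alpha> \<beta> where pos: "0 < \<alpha>" "0 < \<beta>"
    and lower: "\<And>X Y. X \<in> \<K> \<Longrightarrow> Y \<in> \<K> \<Longrightarrow> \<alpha> * coord_dist c X Y \<le> dist_g X Y"
    and upper: "\<And>X Y. X \<in> \<K> \<Longrightarrow> Y \<in> \<K> \<Longrightarrow> dist_g X Y \<le> \<beta> * coord_dist c X Y"
    using dist_comparable[OF c K(1,2) \<open>\<K> \<subseteq> \<V>\<close>] by blast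
  have inv: "Mg (A z, M z) = Mg z" if "z \<in> \<D>" for z
    using \<open>\<forall>(X, Y)\<in>\<W>. Mg (A (X, Y), M (X, Y)) = Mg (X, Y)\<close> that K(3,4) by (cases z) auto
  \<comment> \<open>Pass from \<open>\<delta>\<close> to the coordinate distance (factor \<open>\<beta>\<close>), use the quadratic rate there
      (factor \<open>C\<close>), and pass back (factor \<open>1 / \<alpha>\<close>, squared).\<close>
  show ?thesis
  proof (intro exI[of _ "\<beta> * C / \<alpha>\<^sup>2"] conjI allI impI; (elim conjE)?)
    show "0 < \<beta> * C / \<alpha>\<^sup>2" using pos C by simp
  next
    fix P0 Q0 :: 'p and P Q :: "nat \<Rightarrow> 'p" and \<delta> :: "nat \<Rightarrow> real"
    assume D0: "(P0, Q0) \<in> \<D>"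
      and it: "\<forall>n. (P n, Q n) = mean_iter A M (P0, Q0) n \<and> \<delta> n = dist_g (P n) (Q n)"
    let ?z = "(P0, Q0)" and ?m = "Mg (P0, Q0)" and ?l = "L (P0, Q0)"
    have iter: "mean_iter A M ?z n = (P n, Q n)" and \<delta>: "\<delta> n = dist_g (P n) (Q n)" for n using it by auto
    have D: "(P n, Q n) \<in> \<D>" and quad: "coord_dist c (P (Suc n)) (Q (Suc n))
        \<le> C * (coord_dist c (P n) (Q n))\<^sup>2" for n
      using step[OF D0 iter iter] by auto
    have PQ: "P n \<in> \<K>" "Q n \<in> \<K>" for n using D K(4) by auto
    have V: "P n \<in> \<V>" "Q n \<in> \<V>" for n using PQ \<open>\<K> \<subseteq> \<V>\<close> by auto
    have mid_eq: "mid (P n) (Q n) = ?m" for n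
      using mean_iter_invariant[of A M ?z \<D> Mg n] D inv by (simp add: iter Mg)
    have half: "dist_g (P n) ?m = \<delta> n / 2" "dist_g (Q n) ?m = \<delta> n / 2" for n
      using dist_mid[OF V, of n n] by (simp_all add: mid_eq \<delta>)
    have mV: "?m \<in> \<V>" using mid_in[OF V, of 0 0] by (simp add: mid_eq)
    have lK: "?l \<in> \<K>" and lim: "gauss_limit A M ?z ?l" using L[OF D0] by auto
    have lV: "?l \<in> \<V>" using lK \<open>\<K> \<subseteq> \<V>\<close> by auto
    have lims: "P \<longlonglongrightarrow> ?l" "Q \<longlonglongrightarrow> ?l" using lim by (simp_all add: gauss_limit_def iter)
    have "isCont (snd c) ?l"
      using continuous_on_eq_continuous_at[OF chartD(1)[OF c]] continuous_chart[OF c] lK K(2) by blast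
    then have "(\<lambda>n. snd c (P n)) \<longlonglongrightarrow> snd c ?l" "(\<lambda>n. snd c (Q n)) \<longlonglongrightarrow> snd c ?l"
      using lims isCont_tendsto_compose by blast+
    then have "(\<lambda>n. \<beta> * coord_dist c ?l (P n) + \<beta> * coord_dist c (P n) (Q n) / 2)
        \<longlonglongrightarrow> \<beta> * norm (snd c ?l - snd c ?l) + \<beta> * norm (snd c ?l - snd c ?l) / 2"
      unfolding coord_dist_def by (intro tendsto_intros) auto
    moreover have "dist_g ?l ?m \<le> \<beta> * coord_dist c ?l (P n) + \<beta> * coord_dist c (P n) (Q n) / 2" for n
      using dist_triangle[OF lV V(1) mV, of n] upper[OF lK PQ(1), of n] upper[OF PQ, of n n]
          half(1)[of n] \<delta>[of n]
      by linarith
    ultimately have "dist_g ?l ?m \<le> 0"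
      using LIMSEQ_le_const[of _ _ "dist_g ?l ?m"] by fastforce
    then have eq: "?l = ?m" using dist_zeroD[OF lV mV] dist_nonneg[OF lV mV] by simp
    show "\<exists>l. gauss_limit A M ?z l" using lim by blast
    show "gauss_comp A M ?z = ?m" using gauss_comp_eq[OF lim] eq by simp
    fix n
    show "dist_g (P n) ?m = \<delta> n / 2" "dist_g (Q n) ?m = \<delta> n / 2" by (fact half)+
    have "\<delta> (Suc n) \<le> \<beta> * coord_dist c (P (Suc n)) (Q (Suc n))"
      using upper[OF PQ] by (simp add: \<delta>)
    also have "\<dots> \<le> \<beta> * (C * (coord_dist c (P n) (Q n))\<^sup>2)"
      using quad pos(2) by simp
    also have "\<dots> \<le> \<beta> * (C * (\<delta> n / \<alpha>)\<^sup>2)"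
    proof -
      have "coord_dist c (P n) (Q n) \<le> \<delta> n / \<alpha>"
        using lower[OF PQ, of n n] pos(1) by (simp add: \<delta> field_simps)
      then have "(coord_dist c (P n) (Q n))\<^sup>2 \<le> (\<delta> n / \<alpha>)\<^sup>2"
        by (intro power_mono) (simp_all add: coord_dist_def)
      then show ?thesis using pos(2) C by simp
    qed
    also have "\<dots> = \<beta> * C / \<alpha>\<^sup>2 * (\<delta> n)\<^sup>2" by (simp add: power_divide)
    finally show "\<delta> (Suc n) \<le> \<beta> * C / \<alpha>\<^sup>2 * (\<delta> n)\<^sup>2" .
  qed
qed

end
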